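(* Let $d\ge 2$ and $r\in(0,1)$. Let $M_1,M_2\subset\mathbb{R}^d$ be the closed balls of radius $r$ with centers $\mathbf{x}_1=(-1,0,\dots,0)$ and $\mathbf{x}_2=(1,0,\dots,0)$, let $V_1,V_2$ be independent standard $d$-dimensional normal $\mathcal{N}(\mathbf{0},I_d)$ random vectors, and let $p_{r,d}$ be the probability that the balls $M_1+sV_1$ and $M_2+sV_2$, $s\geq 0$, collide. Then $$p_{r,d}=\frac12 F\left(\frac{1}{d-1}\cdot\frac{r^2}{1-r^2};\,d-1,1\right)=\frac12\int_0^{\frac{1}{d-1}\cdot\frac{r^2}{1-r^2}}\frac{\Gamma\left(\frac d2\right)}{\Gamma\left(\frac{d-1}{2}\right)\sqrt{\pi}}(d-1)^{\frac{d-1}{2}}x^{\frac{d-3}{2}}\left(1+(d-1)x\right)^{-\frac d2}\,dx,$$ where $F(\,\cdot\,;d-1,1)$ is the cumulative distribution function of the $F$-distribution with $d-1$ and $1$ degrees of freedom. It follows that, as $r\to0$, $$p_{r,d}=\frac{1}{d-1}\cdot\frac{\Gamma\left(\frac d2\right)}{\Gamma\left(\frac{d-1}{2}\right)\sqrt{\pi}}\,r^{d-1}+o(r^{d-1}).$$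
   Context: Write $M_i(s)=M_i+sV_i$ for $i=1,2$ and $s\ge0$, and let $T=\inf\{t\ge0: M_1(t)\cap M_2(t)\neq\emptyset\}$ (with $\inf\emptyset=\infty$). The balls collide if and only if $T<\infty$, so $p_{r,d}=\mathbb{P}(T<\infty)$. *)

theory Defs
  imports "HOL-Probability.Probability" "HOL-Library.Landau_Symbols"
begin

definition translate_set :: "(real ^ 'n) set \<Rightarrow> real ^ 'n \<Rightarrow> real \<Rightarrow> (real ^ 'n) set" where
  "translate_set A v s = (\<lambda>x. x + s *\<^sub>R v) ` A"

text \<open>The collision time takes values in \<^typ>\<open>ereal\<close>, where the infimum of the empty set
  is \<open>\<infinity>\<close>.\<close>

definition collision_time ::
    "(real ^ 'n) set \<Rightarrow> (real ^ 'n) set \<Rightarrow> real ^ 'n \<Rightarrow> real ^ 'n \<Rightarrow> ereal" where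
  "collision_time A B v w =
     Inf (ereal ` {t. 0 \<le> t \<and> translate_set A v t \<inter> translate_set B w t \<noteq> {}})"

lemma collision_time_finite_iff:
  "collision_time A B v w < \<infinity> \<longleftrightarrow>
     (\<exists>t\<ge>0. translate_set A v t \<inter> translate_set B w t \<noteq> {})"
  unfolding collision_time_def Inf_less_iff by auto

text \<open>The coordinate \<open>k\<close> plays the role of the first one: \<open>axis k c\<close> is the vector
  \<open>(c, 0, \<dots>, 0)\<close>.\<close>

definition collision_prob ::
    "'w measure \<Rightarrow> 'n::finite \<Rightarrow> ('w \<Rightarrow> real ^ 'n) \<Rightarrow> ('w \<Rightarrow> real ^ 'n) \<Rightarrow> real \<Rightarrow> real" where
  "collision_prob M k V1 V2 r = measure M {\<omega> \<in> space M.
     collision_time (cball (axis k (-1)) r) (cball (axis k 1) r) (V1 \<omega>) (V2 \<omega>) < \<infinity>}"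

text \<open>\<open>V\<close> has law \<open>N(0, I)\<close> on the space \<open>real ^ 'n\<close>.\<close>

definition standard_normal_vector :: "'w measure \<Rightarrow> ('w \<Rightarrow> real ^ 'n) \<Rightarrow> bool" where
  "standard_normal_vector M V \<longleftrightarrow> distributed M lborel V
     (\<lambda>x. ennreal ((2 * pi) powr (- (real CARD('n) / 2)) * exp (- ((norm x)\<^sup>2 / 2))))"

text \<open>Law of the sum of the squares of \<open>k\<close> independent standard normal variables.\<close>

definition chi_squared_distribution :: "nat \<Rightarrow> real measure" where
  "chi_squared_distribution k =
     distr (\<Pi>\<^sub>M i\<in>{..<k}. density lborel (\<lambda>x. ennreal (std_normal_density x))) borel
       (\<lambda>x. \<Sum>i<k. (x i)\<^sup>2)"

text \<open>Law of \<open>(X / m) / (Y / n)\<close> for independent chi-squared variables \<open>X\<close> and \<open>Y\<close> with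
  \<open>m\<close> and \<open>n\<close> degrees of freedom.\<close>

definition F_distribution :: "nat \<Rightarrow> nat \<Rightarrow> real measure" where
  "F_distribution m n =
     distr (chi_squared_distribution m \<Otimes>\<^sub>M chi_squared_distribution n) borel
       (\<lambda>(x, y). (x / real m) / (y / real n))"

end

theory Submission
  imports Defs
begin

text \<open>Only the relative velocity \<open>w = V\<^sub>1 - V\<^sub>2\<close> matters: the balls collide iff \<open>w\<close> lies in the
  half-cone \<open>w\<^sub>k > 0\<close>, \<open>|w\<^sub>\<bottom>|\<^sup>2 \<le> c w\<^sub>k\<^sup>2\<close> with \<open>c = r\<^sup>2 / (1 - r\<^sup>2)\<close>. As \<open>w / \<surd>2\<close> is again standard normal
  and the half-cone is invariant under scaling, reflection in the origin shows that its probability is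
  half that of \<open>|w\<^sub>\<bottom>|\<^sup>2 / w\<^sub>k\<^sup>2 \<le> c\<close>, a ratio of independent chi-squared variables with \<open>d - 1\<close> and \<open>1\<close>
  degrees of freedom. For small \<open>r\<close> the factor \<open>(1 + (d - 1) x)\<close> in the density of that ratio lies
  between \<open>1\<close> and \<open>1 / (1 - r\<^sup>2)\<close>, so that the integral is squeezed between multiples of \<open>r\<^sup>d\<^sup>-\<^sup>1\<close>.\<close>

section \<open>The chi-squared distribution\<close>

text \<open>The parameter \<open>a\<close> is half the number of degrees of freedom.\<close>

definition chi_squared_density :: "real \<Rightarrow> real \<Rightarrow> real" where
  "chi_squared_density a x =
     (if 0 < x then x powr (a - 1) * exp (- x / 2) / (2 powr a * Gamma a) else 0)"

lemma borel_measurable_chi_squared_density [measurable]: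
  "chi_squared_density a \<in> borel_measurable borel"
  unfolding chi_squared_density_def[abs_def] by measurable

lemma chi_squared_density_nonneg [simp]: "0 < a \<Longrightarrow> 0 \<le> chi_squared_density a x"
  by (simp add: chi_squared_density_def)

text \<open>For \<open>a \<ge> 0\<close> the distribution function of the square is the normal mass
  of \<open>{- sqrt a..sqrt a}\<close>. Substituting the square into the integral of the candidate
  density gives twice the normal integral over \<open>{0..sqrt a}\<close>, and symmetry spreads this
  over both signs.\<close>

lemma (in prob_space) distributed_square_std_normal:
  assumes X: "distributed M lborel X std_normal_density"
  shows "distributed M lborel (\<lambda>\<omega>. (X \<omega>)\<^sup>2) (chi_squared_density (1 / 2))"
proof (rule distributedI_borel_atMost)
  have X'[measurable]: "X \<in> borel_measurable M"
    using distributed_measurable[OF X] by simp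
  show "(\<lambda>\<omega>. (X \<omega>)\<^sup>2) \<in> borel_measurable M" by measurable
  show "AE x in lborel. 0 \<le> chi_squared_density (1 / 2) x" by simp
  show "emeasure M {\<omega> \<in> space M. (X \<omega>)\<^sup>2 \<le> a} = ennreal (prob {\<omega> \<in> space M. (X \<omega>)\<^sup>2 \<le> a})" for a
    by (simp add: emeasure_eq_measure)
  fix a :: real
  show "(\<integral>\<^sup>+x. ennreal (chi_squared_density (1 / 2) x * indicator {..a} x) \<partial>lborel) =
    ennreal (prob {\<omega> \<in> space M. (X \<omega>)\<^sup>2 \<le> a})"
  proof (cases "0 \<le> a")
    case False
    then have "(X \<omega>)\<^sup>2 \<le> a \<longleftrightarrow> False" for \<omega>
      by (meson linorder_not_le order_less_le_trans zero_le_power2)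
    moreover have "chi_squared_density (1 / 2) x * indicator {..a} x = 0" for x
      using False by (auto simp: chi_squared_density_def indicator_def)
    ultimately show ?thesis by (simp only: ennreal_0 nn_integral_const) simp
  next
    case True
    \<comment> \<open>The Jacobian of squaring is \<open>2 * x\<close>, so the substituted integrand
      is twice the normal density for \<open>0 < x\<close>; at \<open>0\<close> the cutoff makes it
      vanish.\<close>
    have sq: "chi_squared_density (1 / 2) (x\<^sup>2) * x = std_normal_density x" if "0 < x" for x
    proof -
      have "(x\<^sup>2) powr (1 / 2 - 1) = 1 / x"
        using that by (simp add: powr_minus_divide powr_half_sqrt)
      then show ?thesis
        using that by (simp add: chi_squared_density_def std_normal_density_def Gamma_one_half_real
            powr_half_sqrt real_sqrt_mult)
    qed
    have sqle: "(X \<omega>)\<^sup>2 \<le> a \<longleftrightarrow> - sqrt a \<le> X \<omega> \<and> X \<omega> \<le> sqrt a" for \<omega>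
      using real_sqrt_le_iff[of "(X \<omega>)\<^sup>2" a]
      by (simp add: abs_le_iff minus_le_iff del: real_sqrt_le_iff) linarith
    have reflect: "(\<integral>\<^sup>+x. ennreal (std_normal_density x * indicator {0..sqrt a} x) \<partial>lborel) =
       (\<integral>\<^sup>+x. ennreal (std_normal_density x * indicator {- sqrt a..0} x) \<partial>lborel)"
      by (subst nn_integral_real_affine[of _ "-1" 0])
        (auto intro!: nn_integral_cong simp: indicator_def std_normal_density_def)
    \<comment> \<open>The interval ends are written as squares to fit the substitution rule; cutting
      at \<open>0\<close> loses nothing because the density vanishes on the negative
      half-line.\<close>
    have "(\<integral>\<^sup>+x. ennreal (chi_squared_density (1 / 2) x * indicator {..a} x) \<partial>lborel) =
      (\<integral>\<^sup>+x. ennreal (chi_squared_density (1 / 2) x * indicator {0\<^sup>2..(sqrt a)\<^sup>2} x) \<partial>lborel)"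
      using True by (intro nn_integral_cong) (auto simp: chi_squared_density_def indicator_def)
    also have "\<dots> = (\<integral>\<^sup>+x. ennreal (chi_squared_density (1 / 2) (x\<^sup>2) * (2 * x) * indicator {0..sqrt a} x) \<partial>lborel)"
      by (rule nn_integral_substitution)
        (use True in \<open>auto intro!: derivative_eq_intros continuous_intros simp: set_borel_measurable_def\<close>)
    \<comment> \<open>The two integrands differ only at \<open>0\<close>, a null set, where the left
      one is \<open>0\<close>.\<close>
    also have "\<dots> = (\<integral>\<^sup>+x. 2 * ennreal (std_normal_density x * indicator {0..sqrt a} x) \<partial>lborel)"
      by (intro nn_integral_cong_AE AE_I[of _ _ "{0}"])
        (auto simp: indicator_def ennreal_mult[symmetric] ennreal_numeral[symmetric]
          simp del: ennreal_numeral split: if_splits, metis order_le_less sq)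
    also have "\<dots> = (\<integral>\<^sup>+x. ennreal (std_normal_density x * indicator {0..sqrt a} x) \<partial>lborel) +
       (\<integral>\<^sup>+x. ennreal (std_normal_density x * indicator {0..sqrt a} x) \<partial>lborel)"
      by (simp add: mult_2 nn_integral_add)
    also have "\<dots> = (\<integral>\<^sup>+x. ennreal (std_normal_density x * indicator {- sqrt a..0} x) \<partial>lborel) +
       (\<integral>\<^sup>+x. ennreal (std_normal_density x * indicator {0..sqrt a} x) \<partial>lborel)"
      by (simp only: reflect)
    also have "\<dots> =
       (\<integral>\<^sup>+x. ennreal (std_normal_density x * indicator {- sqrt a..0} x) +
          ennreal (std_normal_density x * indicator {0..sqrt a} x) \<partial>lborel)"
      by (rule nn_integral_add[symmetric]) auto
    \<comment> \<open>The sum of the two indicators counts the point \<open>0\<close> twice, again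
      only a null set.\<close>
    also have "\<dots> = (\<integral>\<^sup>+x. ennreal (std_normal_density x) * indicator {- sqrt a..sqrt a} x \<partial>lborel)"
      using True by (intro nn_integral_cong_AE AE_I[of _ _ "{0}"]) (auto simp: indicator_def split: if_splits)
    also have "\<dots> = emeasure M (X -` {- sqrt a..sqrt a} \<inter> space M)"
      by (rule distributed_emeasure[OF X, symmetric]) simp
    also have "X -` {- sqrt a..sqrt a} \<inter> space M = {\<omega> \<in> space M. (X \<omega>)\<^sup>2 \<le> a}"
      by (auto simp: sqle)
    finally show ?thesis by (simp add: emeasure_eq_measure)
  qed
qed measurable

section \<open>Sums of squares by convolution\<close>

lemma nn_integral_Beta:
  assumes "0 < a" "0 < b"
  shows "(\<integral>\<^sup>+t. ennreal (t powr (a - 1) * (1 - t) powr (b - 1)) * indicator {0..1} t \<partial>lborel) = ennreal (Beta a b)"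
  by (rule nn_integral_has_integral_lebesgue'[OF _ has_integral_Beta_real[OF assms]]) simp

text \<open>The substitution \<open>y = x * t\<close> pulls all dependence on \<open>x\<close> out
  of the integral and leaves a Beta integral, whose value
  \<open>Gamma a * Gamma b / Gamma (a + b)\<close> trades the two normalising constants for the one
  of \<open>a + b\<close>.\<close>

lemma convolution_chi_squared_density:
  assumes "0 < a" "0 < b"
  shows "(\<integral>\<^sup>+y. ennreal (chi_squared_density a (x - y)) * ennreal (chi_squared_density b y) \<partial>lborel) =
    ennreal (chi_squared_density (a + b) x)"
proof (cases "0 < x")
  case False
  then have "ennreal (chi_squared_density a (x - y)) * ennreal (chi_squared_density b y) = 0" for y
    by (auto simp: chi_squared_density_def)
  then show ?thesis using False by (simp only: nn_integral_const) (simp add: chi_squared_density_def)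
next
  case True
  \<comment> \<open>All factors of the substituted integrand that do not depend on \<open>t\<close>.
    The Jacobian \<open>x\<close> stays outside and later raises the exponent
    \<open>a + b - 2\<close> to \<open>a + b - 1\<close>.\<close>
  define C where "C = exp (- x / 2) / (2 powr (a + b) * Gamma a * Gamma b) * x powr (a + b - 2)"
  have C: "0 \<le> C" and Beta: "0 \<le> Beta b a" using assms by (simp_all add: C_def Beta_def)
  have "(\<integral>\<^sup>+y. ennreal (chi_squared_density a (x - y)) * ennreal (chi_squared_density b y) \<partial>lborel) =
     ennreal \<bar>x\<bar> * (\<integral>\<^sup>+t. ennreal (chi_squared_density a (x - (0 + x * t))) * ennreal (chi_squared_density b (0 + x * t)) \<partial>lborel)"
    using True by (intro nn_integral_real_affine) auto
  also have "(\<integral>\<^sup>+t. ennreal (chi_squared_density a (x - (0 + x * t))) * ennreal (chi_squared_density b (0 + x * t)) \<partial>lborel) =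
     (\<integral>\<^sup>+t. ennreal C * (ennreal (t powr (b - 1) * (1 - t) powr (a - 1)) * indicator {0..1} t) \<partial>lborel)"
  proof (intro nn_integral_cong)
    fix t :: real
    \<comment> \<open>At \<open>t = 0\<close> and \<open>t = 1\<close> both sides vanish: the left
      one by the cutoff in the density, the right one because \<open>0 powr z = 0\<close> for every
      \<open>z\<close>.\<close>
    consider "t \<le> 0" | "1 \<le> t" | "0 < t" "t < 1" by linarith
    then show "ennreal (chi_squared_density a (x - (0 + x * t))) * ennreal (chi_squared_density b (0 + x * t)) =
      ennreal C * (ennreal (t powr (b - 1) * (1 - t) powr (a - 1)) * indicator {0..1} t)"
    proof cases
      case 3
      have e: "x - x * t = x * (1 - t)" by (simp add: algebra_simps)
      have "exp (- (x * (1 - t)) / 2) * exp (- (x * t) / 2) = exp (- x / 2)"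
        by (simp add: exp_add[symmetric] field_simps)
      moreover have "x powr (a - 1) * x powr (b - 1) = x powr (a + b - 2)"
        by (simp add: powr_add[symmetric])
      moreover have "(2::real) powr a * 2 powr b = 2 powr (a + b)" by (simp add: powr_add)
      moreover have "chi_squared_density a (x * (1 - t)) * chi_squared_density b (x * t) =
        (exp (- (x * (1 - t)) / 2) * exp (- (x * t) / 2)) * (x powr (a - 1) * x powr (b - 1)) /
        ((2 powr a * 2 powr b) * Gamma a * Gamma b) * (t powr (b - 1) * (1 - t) powr (a - 1))"
        using 3 True by (simp add: chi_squared_density_def powr_mult mult_ac)
      ultimately have "chi_squared_density a (x * (1 - t)) * chi_squared_density b (x * t) =
        C * (t powr (b - 1) * (1 - t) powr (a - 1))"
        by (simp add: C_def)
      then show ?thesis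
        using 3 C assms by (simp add: e ennreal_mult[symmetric])
    qed (use True in \<open>auto simp: chi_squared_density_def indicator_def zero_less_mult_iff\<close>)
  qed
  also have "\<dots> = ennreal C * ennreal (Beta b a)"
    by (simp add: nn_integral_cmult nn_integral_Beta assms)
  also have "ennreal \<bar>x\<bar> * \<dots> = ennreal (x * (C * Beta b a))"
    using C True Beta by (simp add: ennreal_mult[symmetric])
  also have "x * (C * Beta b a) = chi_squared_density (a + b) x"
  proof -
    have "x * x powr (a + b - 2) = x powr (a + b - 1)"
      using True by (simp add: powr_mult_base)
    moreover have "Gamma a \<noteq> 0" "Gamma b \<noteq> 0"
      using assms Gamma_real_pos by (metis less_irrefl)+
    moreover have "x * (C * Beta b a) = (x * x powr (a + b - 2)) * exp (- x / 2) /
        (2 powr (a + b) * (Gamma a * Gamma b)) * (Gamma a * Gamma b / Gamma (a + b))"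
      by (simp add: C_def Beta_def add.commute mult_ac)
    ultimately show ?thesis
      using True by (simp add: chi_squared_density_def)
  qed
  finally show ?thesis .
qed

text \<open>Induction on the index set, starting from a singleton since an empty sum has no density.
  Each new independent square convolves with the density of parameter \<open>1 / 2\<close>.\<close>

lemma (in prob_space) distributed_sum_squares_std_normal:
  assumes "finite I" "I \<noteq> {}" "indep_vars (\<lambda>_. borel) X I"
    and "\<And>i. i \<in> I \<Longrightarrow> distributed M lborel (X i) std_normal_density"
  shows "distributed M lborel (\<lambda>\<omega>. \<Sum>i\<in>I. (X i \<omega>)\<^sup>2) (chi_squared_density (real (card I) / 2))"
  using assms
proof (induct I rule: finite_ne_induct)
  case (singleton i)
  then show ?case by (simp add: distributed_square_std_normal)
next
  case (insert i I)
  have sq: "indep_vars (\<lambda>_. borel) (\<lambda>i \<omega>. (X i \<omega>)\<^sup>2) (insert i I)"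
    by (rule indep_vars_compose2[OF insert.prems(1)]) simp
  have "indep_vars (\<lambda>_. borel) X I"
    using insert.prems(1) by (rule indep_vars_subset) auto
  then have IH: "distributed M lborel (\<lambda>\<omega>. \<Sum>i\<in>I. (X i \<omega>)\<^sup>2) (chi_squared_density (real (card I) / 2))"
    using insert by blast
  have pos: "0 < real (card I) / 2" using insert by (simp add: card_gt_0_iff)
  have "distributed M lborel (\<lambda>\<omega>. (X i \<omega>)\<^sup>2 + (\<Sum>i\<in>I. (X i \<omega>)\<^sup>2))
     (\<lambda>x. \<integral>\<^sup>+y. ennreal (chi_squared_density (1 / 2) (x - y)) *
        ennreal (chi_squared_density (real (card I) / 2) y) \<partial>lborel)"
    by (intro distributed_convolution indep_vars_sum sq IH distributed_square_std_normal insert) auto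
  moreover have "1 / 2 + real (card I) / 2 = real (card (insert i I)) / 2"
    using insert by (simp add: add_divide_distrib)
  ultimately show ?case
    using insert.hyps unfolding convolution_chi_squared_density[OF half_gt_zero[OF zero_less_one] pos]
    by simp
qed

section \<open>Coordinates of a product measure\<close>

text \<open>Independence means that the joint law is the product of the marginals. Here the joint
  law of the coordinates is the product measure itself, and its marginals are the factors.\<close>

lemma indep_vars_PiM_coord:
  assumes "finite I" "I \<noteq> {}" "\<And>i. i \<in> I \<Longrightarrow> prob_space (N i)"
  shows "prob_space.indep_vars (\<Pi>\<^sub>M i\<in>I. N i) N (\<lambda>i x. x i) I"
    and "i \<in> I \<Longrightarrow> distr (\<Pi>\<^sub>M i\<in>I. N i) (N i) (\<lambda>x. x i) = N i"
proof -
  \<comment> \<open>The locale of product probability spaces asks for a probability measure at every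
    index, so the family is filled up outside \<open>I\<close> by a point mass.\<close>
  define N' where "N' i = (if i \<in> I then N i else return (count_space UNIV) undefined)" for i
  have P_eq: "(\<Pi>\<^sub>M i\<in>I. N i) = (\<Pi>\<^sub>M i\<in>I. N' i)"
    by (intro PiM_cong) (auto simp: N'_def)
  interpret N': product_prob_space N' I
    by (rule product_prob_spaceI) (auto simp: N'_def assms intro!: prob_space_return)
  interpret P: prob_space "\<Pi>\<^sub>M i\<in>I. N i"
    by (rule prob_space_PiM) (rule assms)
  have coord: "distr (\<Pi>\<^sub>M i\<in>I. N i) (N i) (\<lambda>x. x i) = N i" if "i \<in> I" for i
    using N'.PiM_component[of i] that unfolding P_eq by (simp add: N'_def)
  then show "i \<in> I \<Longrightarrow> distr (\<Pi>\<^sub>M i\<in>I. N i) (N i) (\<lambda>x. x i) = N i" .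
  show "P.indep_vars N (\<lambda>i x. x i) I"
  proof (subst P.indep_vars_iff_distr_eq_PiM')
    have "distr (\<Pi>\<^sub>M i\<in>I. N i) (\<Pi>\<^sub>M i\<in>I. N i) (\<lambda>x. \<lambda>i\<in>I. x i) =
        distr (\<Pi>\<^sub>M i\<in>I. N i) (\<Pi>\<^sub>M i\<in>I. N i) (\<lambda>x. x)"
      by (intro distr_cong) (auto simp: space_PiM)
    also have "\<dots> = (\<Pi>\<^sub>M i\<in>I. N i)" by (rule distr_id)
    also have "\<dots> = (\<Pi>\<^sub>M i\<in>I. distr (\<Pi>\<^sub>M i\<in>I. N i) (N i) (\<lambda>x. x i))"
      using coord by (intro PiM_cong) auto
    finally show "distr (\<Pi>\<^sub>M i\<in>I. N i) (\<Pi>\<^sub>M i\<in>I. N i) (\<lambda>x. \<lambda>i\<in>I. x i) =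
      (\<Pi>\<^sub>M i\<in>I. distr (\<Pi>\<^sub>M i\<in>I. N i) (N i) (\<lambda>x. x i))" .
  qed (use assms in auto)
qed

lemma PiM_std_normal:
  assumes "finite I" "I \<noteq> {}"
  defines "P \<equiv> (\<Pi>\<^sub>M i\<in>I. density lborel (\<lambda>x. ennreal (std_normal_density x)))"
  shows "prob_space P"
    and "prob_space.indep_vars P (\<lambda>_. borel) (\<lambda>i x. x i) I"
    and "i \<in> I \<Longrightarrow> distributed P lborel (\<lambda>x. x i) std_normal_density"
proof -
  have N: "prob_space (density lborel (\<lambda>x. ennreal (std_normal_density x)))"
    by (rule prob_space_normal_density) simp
  show P: "prob_space P" unfolding P_def by (rule prob_space_PiM) (rule N)
  then interpret P: prob_space P .
  have "P.indep_vars (\<lambda>_. density lborel (\<lambda>x. ennreal (std_normal_density x))) (\<lambda>i x. x i) I"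
    unfolding P_def by (rule indep_vars_PiM_coord(1)) (use assms N in auto)
  \<comment> \<open>Composition with the identity only replaces the target spaces by
    \<open>borel\<close>, which has the same measurable sets.\<close>
  then show "P.indep_vars (\<lambda>_. borel) (\<lambda>i x. x i) I"
    by (rule P.indep_vars_compose2[where Y="\<lambda>_ x. x"]) auto
  show "i \<in> I \<Longrightarrow> distributed P lborel (\<lambda>x. x i) std_normal_density"
    using indep_vars_PiM_coord(2)[OF assms(1,2) N, of i]
    by (simp add: distributed_def P_def cong: distr_cong)
qed

lemma chi_squared_distribution_eq_density:
  assumes "0 < k"
  shows "chi_squared_distribution k = density lborel (chi_squared_density (real k / 2))"
proof -
  have I: "finite {..<k}" "{..<k} \<noteq> {}" using assms by auto
  interpret P: prob_space "\<Pi>\<^sub>M i\<in>{..<k}. density lborel (\<lambda>x. ennreal (std_normal_density x))"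
    by (rule PiM_std_normal(1)[OF I])
  show ?thesis
    using P.distributed_sum_squares_std_normal[OF I PiM_std_normal(2)[OF I] PiM_std_normal(3)[OF I]]
    by (simp add: chi_squared_distribution_def distributed_def cong: distr_cong)
qed

section \<open>The F-distribution with one denominator degree of freedom\<close>

lemma nn_integral_Gamma:
  assumes "0 < s" "0 < l"
  shows "(\<integral>\<^sup>+y. ennreal (y powr (s - 1) * exp (- l * y)) * indicator {0..} y \<partial>lborel) =
    ennreal (Gamma s / l powr s)"
proof -
  have 1: "(\<integral>\<^sup>+y. ennreal (y powr (s - 1) / exp y) * indicator {0..} y \<partial>lborel) = ennreal (Gamma s)"
    by (rule nn_integral_has_integral_lebesgue'[OF _ Gamma_integral_real]) (use assms in auto)
  have "(\<integral>\<^sup>+y. ennreal (y powr (s - 1) * exp (- l * y)) * indicator {0..} y \<partial>lborel) =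
    ennreal \<bar>1 / l\<bar> * (\<integral>\<^sup>+y. ennreal ((0 + 1 / l * y) powr (s - 1) * exp (- l * (0 + 1 / l * y))) *
      indicator {0..} (0 + 1 / l * y) \<partial>lborel)"
    using assms by (intro nn_integral_real_affine) auto
  also have "(\<integral>\<^sup>+y. ennreal ((0 + 1 / l * y) powr (s - 1) * exp (- l * (0 + 1 / l * y))) *
      indicator {0..} (0 + 1 / l * y) \<partial>lborel) =
    (\<integral>\<^sup>+y. ennreal (1 / l powr (s - 1)) * (ennreal (y powr (s - 1) / exp y) * indicator {0..} y) \<partial>lborel)"
    using assms by (intro nn_integral_cong)
      (auto simp: indicator_def powr_divide exp_minus field_simps zero_le_divide_iff ennreal_mult[symmetric])
  also have "\<dots> = ennreal (1 / l powr (s - 1)) * ennreal (Gamma s)"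
    by (simp add: nn_integral_cmult 1)
  also have "ennreal \<bar>1 / l\<bar> * \<dots> = ennreal (1 / l * (1 / l powr (s - 1) * Gamma s))"
    using assms Gamma_real_pos[of s] by (simp add: ennreal_mult[symmetric])
  also have "1 / l * (1 / l powr (s - 1) * Gamma s) = Gamma s / l powr s"
    using assms by (simp add: powr_diff)
  finally show ?thesis .
qed

text \<open>The density of the F-distribution with \<open>m\<close> and \<open>1\<close> degrees of
  freedom on the positive half-line. The formula has no cutoff; \<open>indicator {0..}\<close> is
  attached wherever it is used as a density on the whole line.\<close>

definition F_density :: "nat \<Rightarrow> real \<Rightarrow> real" where
  "F_density m x = Gamma ((real m + 1) / 2) / (Gamma (real m / 2) * sqrt pi) *
     real m powr (real m / 2) * x powr (real m / 2 - 1) * (1 + real m * x) powr (- ((real m + 1) / 2))"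

lemma borel_measurable_F_density [measurable]: "F_density m \<in> borel_measurable borel"
  unfolding F_density_def[abs_def] by measurable

lemma F_density_nonneg: "0 < m \<Longrightarrow> 0 \<le> F_density m x"
  using Gamma_real_pos[of "(real m + 1) / 2"] Gamma_real_pos[of "real m / 2"]
  by (auto simp: F_density_def intro!: mult_nonneg_nonneg divide_nonneg_nonneg)

text \<open>The left side is the density at \<open>u\<close> of \<open>(X / m) / Y\<close>, obtained
  by integrating over the value \<open>y\<close> of \<open>Y\<close>;
  \<open>\<bar>real m * y\<bar>\<close> is the Jacobian of \<open>x = real m * y * u\<close>. As a
  function of \<open>y\<close> the integrand is a Gamma integrand.\<close>

lemma nn_integral_F_density:
  assumes m: "0 < m"
  shows "(\<integral>\<^sup>+y. ennreal (chi_squared_density (1 / 2) y) * (ennreal \<bar>real m * y\<bar> *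
      ennreal (chi_squared_density (real m / 2) (real m * y * u))) \<partial>lborel) =
    ennreal (F_density m u * indicator {0..} u)"
proof (cases "0 < u")
  case False
  have "ennreal (chi_squared_density (1 / 2) y) * (ennreal \<bar>real m * y\<bar> *
      ennreal (chi_squared_density (real m / 2) (real m * y * u))) = 0" for y
    using False m by (auto simp: chi_squared_density_def zero_less_mult_iff mult_less_0_iff)
  \<comment> \<open>At \<open>u = 0\<close> the indicator is \<open>1\<close>, but the factor
    \<open>u powr (real m / 2 - 1)\<close> is \<open>0\<close> by convention.\<close>
  moreover have "F_density m u * indicator {0..} u = 0"
    using False by (auto simp: F_density_def indicator_def)
  ultimately show ?thesis by (simp only: nn_integral_const) simp
next
  case True
  \<comment> \<open>Shape and rate of the Gamma integrand: the powers of \<open>y\<close> have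
    exponents \<open>- 1 / 2\<close>, \<open>1\<close> and \<open>real m / 2 - 1\<close>, which add
    up to \<open>s - 1\<close>, and the two exponentials merge to \<open>exp (- l * y)\<close>. The
    constant \<open>K\<close> holds the rest.\<close>
  define s where "s = (real m + 1) / 2"
  define l where "l = (1 + real m * u) / 2"
  define K where "K = real m powr (real m / 2) * u powr (real m / 2 - 1) /
    (2 powr s * sqrt pi * Gamma (real m / 2))"
  have s: "0 < s" and l: "0 < l" and Gm: "0 < Gamma (real m / 2)"
    using True m by (auto simp: s_def l_def Gamma_real_pos add_pos_nonneg)
  then have K: "0 \<le> K" by (auto simp: K_def intro!: divide_nonneg_nonneg mult_nonneg_nonneg)
  have "(\<integral>\<^sup>+y. ennreal (chi_squared_density (1 / 2) y) * (ennreal \<bar>real m * y\<bar> *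
      ennreal (chi_squared_density (real m / 2) (real m * y * u))) \<partial>lborel) =
    (\<integral>\<^sup>+y. ennreal K * (ennreal (y powr (s - 1) * exp (- l * y)) * indicator {0..} y) \<partial>lborel)"
  proof (intro nn_integral_cong)
    fix y :: real
    consider "y < 0" | "y = 0" | "0 < y" by linarith
    then show "ennreal (chi_squared_density (1 / 2) y) * (ennreal \<bar>real m * y\<bar> *
        ennreal (chi_squared_density (real m / 2) (real m * y * u))) =
      ennreal K * (ennreal (y powr (s - 1) * exp (- l * y)) * indicator {0..} y)"
    proof cases
      case 3
      have e: "exp (- y / 2) * exp (- (real m * y * u) / 2) = exp (- l * y)"
        by (simp add: exp_add[symmetric] l_def field_simps)
      have p: "y powr (1 / 2 - 1) * (real m * y) * (real m * y * u) powr (real m / 2 - 1) =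
        real m powr (real m / 2) * u powr (real m / 2 - 1) * y powr (s - 1)"
      proof -
        have "y powr (1 / 2 - 1) * y * y powr (real m / 2 - 1) = y powr (s - 1)"
          using 3 by (simp add: s_def powr_mult_base powr_add[symmetric] mult.commute[of _ y] field_simps)
        moreover have "real m * real m powr (real m / 2 - 1) = real m powr (real m / 2)"
          using m by (simp add: powr_mult_base)
        moreover have "y powr (1 / 2 - 1) * (real m * y) * (real m * y * u) powr (real m / 2 - 1) =
          (real m * real m powr (real m / 2 - 1)) * u powr (real m / 2 - 1) *
          (y powr (1 / 2 - 1) * y * y powr (real m / 2 - 1))"
          using 3 True m by (simp add: powr_mult mult_ac)
        ultimately show ?thesis by simp
      qed
      have t: "2 powr (1 / 2) * 2 powr (real m / 2) = (2::real) powr s"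
        by (simp add: s_def powr_add[symmetric] add_divide_distrib add.commute)
      have "chi_squared_density (1 / 2) y * ((real m * y) * chi_squared_density (real m / 2) (real m * y * u)) =
        (y powr (1 / 2 - 1) * (real m * y) * (real m * y * u) powr (real m / 2 - 1)) *
        (exp (- y / 2) * exp (- (real m * y * u) / 2)) /
        ((2 powr (1 / 2) * 2 powr (real m / 2)) * sqrt pi * Gamma (real m / 2))"
        using 3 True m by (simp add: chi_squared_density_def Gamma_one_half_real mult_ac)
      also have "\<dots> = K * (y powr (s - 1) * exp (- l * y))"
        unfolding e p t by (simp add: K_def)
      finally show ?thesis
        using 3 K m True by (simp add: ennreal_mult[symmetric])
    qed (auto simp: chi_squared_density_def)
  qed
  also have "\<dots> = ennreal K * ennreal (Gamma s / l powr s)"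
    using nn_integral_Gamma[OF s l] by (simp add: nn_integral_cmult)
  also have "\<dots> = ennreal (K * (Gamma s / l powr s))"
    using K s l Gamma_real_pos[of s] by (simp add: ennreal_mult[symmetric])
  also have "K * (Gamma s / l powr s) = F_density m u"
    using True m by (simp add: K_def l_def F_density_def s_def[symmetric] powr_divide powr_minus divide_simps)
  finally show ?thesis using True by simp
qed

text \<open>For fixed \<open>y\<close> the inner integral is rescaled by
  \<open>x = real m * y * u\<close>, so that the indicator of \<open>B\<close> depends on
  \<open>u\<close> alone; swapping the integrals then leaves the density in
  \<open>u\<close>.\<close>

lemma F_distribution_eq_density:
  assumes m: "0 < m"
  shows "F_distribution m 1 = density lborel (\<lambda>u. ennreal (F_density m u * indicator {0..} u))"
proof (rule measure_eqI)
  show "sets (F_distribution m 1) = sets (density lborel (\<lambda>u. ennreal (F_density m u * indicator {0..} u)))"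
    by (simp add: F_distribution_def)
  fix B assume "B \<in> sets (F_distribution m 1)"
  then have [measurable]: "B \<in> sets borel" by (simp add: F_distribution_def)
  let ?X = "density lborel (\<lambda>x. ennreal (chi_squared_density (real m / 2) x))"
  let ?Y = "density lborel (\<lambda>x. ennreal (chi_squared_density (1 / 2) x))"
  \<comment> \<open>Total mass \<open>1\<close> is read off the construction from normal variables,
    without integrating the densities; it supplies the sigma-finiteness needed for swapping
    integrals.\<close>
  have prob: "prob_space (chi_squared_distribution k)" for k
    unfolding chi_squared_distribution_def
    by (intro prob_space.prob_space_distr prob_space_PiM prob_space_normal_density) auto
  have X: "chi_squared_distribution m = ?X" and Y: "chi_squared_distribution 1 = ?Y"
    using chi_squared_distribution_eq_density[of m] chi_squared_distribution_eq_density[of 1] m by auto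
  interpret X: prob_space ?X using prob[of m] X by simp
  interpret Y: prob_space ?Y using prob[of 1] Y by simp
  interpret XY: pair_sigma_finite ?X ?Y ..
  have "emeasure (F_distribution m 1) B =
     (\<integral>\<^sup>+z. indicator B ((fst z / real m) / (snd z / real 1)) \<partial>(?X \<Otimes>\<^sub>M ?Y))"
    unfolding F_distribution_def X Y
    by (subst nn_integral_indicator[symmetric], simp, subst nn_integral_distr) (auto simp: case_prod_beta)
  also have "\<dots> = (\<integral>\<^sup>+y. \<integral>\<^sup>+x. indicator B ((x / real m) / y) \<partial>?X \<partial>?Y)"
    by (subst XY.nn_integral_snd[symmetric]) auto
  also have "\<dots> = (\<integral>\<^sup>+y. ennreal (chi_squared_density (1 / 2) y) *
     (\<integral>\<^sup>+x. ennreal (chi_squared_density (real m / 2) x) * indicator B ((x / real m) / y) \<partial>lborel) \<partial>lborel)"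
    by (simp add: nn_integral_density)
  also have "\<dots> = (\<integral>\<^sup>+y. ennreal (chi_squared_density (1 / 2) y) *
     (ennreal \<bar>real m * y\<bar> *
       (\<integral>\<^sup>+u. ennreal (chi_squared_density (real m / 2) (real m * y * u)) * indicator B u \<partial>lborel)) \<partial>lborel)"
  \<comment> \<open>The rescaling needs a nonzero factor, so the null set \<open>{0}\<close> of
    values of \<open>y\<close> is left out.\<close>
  proof (intro nn_integral_cong_AE AE_I[of _ _ "{0}"])
    have "(\<integral>\<^sup>+x. ennreal (chi_squared_density (real m / 2) x) * indicator B ((x / real m) / y) \<partial>lborel) =
      ennreal \<bar>real m * y\<bar> *
       (\<integral>\<^sup>+u. ennreal (chi_squared_density (real m / 2) (real m * y * u)) * indicator B u \<partial>lborel)"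
      if "y \<noteq> 0" for y
      by (subst nn_integral_real_affine[where c="real m * y" and t=0])
        (use that m in \<open>auto simp: field_simps\<close>)
    then show "{y \<in> space lborel. \<not> ennreal (chi_squared_density (1 / 2) y) *
     (\<integral>\<^sup>+x. ennreal (chi_squared_density (real m / 2) x) * indicator B ((x / real m) / y) \<partial>lborel) =
      ennreal (chi_squared_density (1 / 2) y) * (ennreal \<bar>real m * y\<bar> *
       (\<integral>\<^sup>+u. ennreal (chi_squared_density (real m / 2) (real m * y * u)) * indicator B u \<partial>lborel))} \<subseteq> {0}"
      by force
  qed auto
  also have "\<dots> = (\<integral>\<^sup>+y. \<integral>\<^sup>+u. ennreal (chi_squared_density (1 / 2) y) * (ennreal \<bar>real m * y\<bar> *
      ennreal (chi_squared_density (real m / 2) (real m * y * u))) * indicator B u \<partial>lborel \<partial>lborel)"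
    by (simp add: nn_integral_cmult[symmetric] mult.assoc)
  also have "\<dots> = (\<integral>\<^sup>+u. \<integral>\<^sup>+y. ennreal (chi_squared_density (1 / 2) y) * (ennreal \<bar>real m * y\<bar> *
      ennreal (chi_squared_density (real m / 2) (real m * y * u))) * indicator B u \<partial>lborel \<partial>lborel)"
    by (intro lborel_pair.Fubini') simp
  also have "\<dots> = (\<integral>\<^sup>+u. ennreal (F_density m u * indicator {0..} u) * indicator B u \<partial>lborel)"
    by (subst nn_integral_multc) (simp_all add: nn_integral_F_density[OF m])
  also have "\<dots> = emeasure (density lborel (\<lambda>u. ennreal (F_density m u * indicator {0..} u))) B"
    by (simp add: emeasure_density)
  finally show "emeasure (F_distribution m 1) B =
    emeasure (density lborel (\<lambda>u. ennreal (F_density m u * indicator {0..} u))) B" .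
qed

lemma cdf_F_distribution:
  assumes "0 < m"
  shows "cdf (F_distribution m 1) q = (LBINT x:{0..q}. F_density m x)"
proof -
  have "emeasure (F_distribution m 1) {..q} = (\<integral>\<^sup>+x. ennreal (indicator {0..q} x *\<^sub>R F_density m x) \<partial>lborel)"
    unfolding F_distribution_eq_density[OF assms]
    by (subst emeasure_density) (auto intro!: nn_integral_cong simp: indicator_def)
  then show ?thesis
    unfolding cdf_def measure_def set_lebesgue_integral_def
    by (subst integral_eq_nn_integral) (auto simp: F_density_nonneg[OF assms])
qed

section \<open>Standard normal vectors\<close>

lemma nn_integral_lborel_affine:
  fixes f :: "'a::euclidean_space \<Rightarrow> ennreal"
  assumes [measurable]: "f \<in> borel_measurable borel" and c: "c \<noteq> 0"
  shows "(\<integral>\<^sup>+x. f x \<partial>lborel) = ennreal (\<bar>c\<bar> ^ DIM('a)) * (\<integral>\<^sup>+x. f (t + c *\<^sub>R x) \<partial>lborel)"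
  by (subst lborel_affine[OF c, of t])
    (simp add: nn_integral_density nn_integral_distr nn_integral_cmult)

definition std_normal_vec_density :: "real ^ 'n \<Rightarrow> real" where
  "std_normal_vec_density x = (2 * pi) powr (- (real CARD('n) / 2)) * exp (- ((norm x)\<^sup>2 / 2))"

lemma std_normal_vec_density_nonneg [simp]: "0 \<le> std_normal_vec_density x"
  by (simp add: std_normal_vec_density_def)

lemma borel_measurable_std_normal_vec_density [measurable]:
  "std_normal_vec_density \<in> borel_measurable borel"
  unfolding std_normal_vec_density_def[abs_def] by measurable

lemma standard_normal_vector_iff:
  "standard_normal_vector M V \<longleftrightarrow> distributed M lborel V (\<lambda>x. ennreal (std_normal_vec_density x))"
  by (simp add: standard_normal_vector_def std_normal_vec_density_def)

lemma standard_normal_vector_distr: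
  "standard_normal_vector M V \<Longrightarrow> V \<in> borel_measurable M"
  "standard_normal_vector M V \<Longrightarrow> distr M borel V = density lborel (\<lambda>x. ennreal (std_normal_vec_density x))"
  by (simp_all add: standard_normal_vector_iff distributed_def cong: distr_cong)

lemma (in prob_space) distr_diff_standard_normal_vector:
  fixes V1 V2 :: "'a \<Rightarrow> real ^ 'n"
  assumes V1: "standard_normal_vector M V1" and V2: "standard_normal_vector M V2"
    and ind: "indep_var borel V1 borel V2"
  shows "distr M borel (\<lambda>\<omega>. (1 / sqrt 2) *\<^sub>R (V1 \<omega> - V2 \<omega>)) =
    density lborel (\<lambda>x. ennreal (std_normal_vec_density x))"
proof -
  note [measurable] = standard_normal_vector_distr(1)[OF V1] standard_normal_vector_distr(1)[OF V2]
  note D = standard_normal_vector_distr(2)[OF V1] standard_normal_vector_distr(2)[OF V2]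
  let ?p = "\<lambda>x::real ^ 'n. ennreal (std_normal_vec_density x)"
  let ?L = "density lborel ?p"
  let ?W = "\<lambda>\<omega>. (1 / sqrt 2) *\<^sub>R (V1 \<omega> - V2 \<omega>)"
  interpret L: prob_space ?L
    unfolding D(1)[symmetric] by (rule prob_space_distr) simp
  interpret LL: pair_sigma_finite ?L ?L ..
  \<comment> \<open>Completing the square splits the joint density of \<open>(w + \<surd>2 z, w)\<close> into the density of \<open>z\<close>
    and a shifted Gaussian in \<open>w\<close>, whose integral \<open>K\<close> need not be computed: it is \<open>1\<close> because
    both laws have total mass \<open>1\<close>.\<close>
  define K where "K = ennreal (sqrt 2 ^ CARD('n)) *
    (\<integral>\<^sup>+w. ennreal ((2 * pi) powr (- (real CARD('n) / 2)) * exp (- (norm (w :: real ^ 'n))\<^sup>2)) \<partial>lborel)"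
  \<comment> \<open>The scalar in \<open>1 *\<^sub>R w\<close> gives the argument the shape
    \<open>t + c *\<^sub>R x\<close>, so that the affine change of variables with
    \<open>c = 1\<close> matches it below.\<close>
  have sq: "?p (w + sqrt 2 *\<^sub>R z) * ?p w =
     ennreal ((2 * pi) powr (- (real CARD('n) / 2)) * exp (- (norm ((1 / sqrt 2) *\<^sub>R z + 1 *\<^sub>R w))\<^sup>2)) * ?p z"
    for w z :: "real ^ 'n"
  proof -
    have s: "1 / sqrt 2 = sqrt 2 / 2" by (simp add: real_div_sqrt field_simps)
    have s2: "sqrt 2 * (sqrt 2 * x) = 2 * x" for x by simp
    have "(norm (w + sqrt 2 *\<^sub>R z))\<^sup>2 / 2 + (norm w)\<^sup>2 / 2 =
      (norm ((1 / sqrt 2) *\<^sub>R z + 1 *\<^sub>R w))\<^sup>2 + (norm z)\<^sup>2 / 2"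
      unfolding s power2_norm_eq_inner by (simp add: inner_simps inner_commute algebra_simps s2)
        (simp add: field_simps)
    then have "exp (- ((norm (w + sqrt 2 *\<^sub>R z))\<^sup>2 / 2)) * exp (- ((norm w)\<^sup>2 / 2)) =
      exp (- (norm ((1 / sqrt 2) *\<^sub>R z + 1 *\<^sub>R w))\<^sup>2) * exp (- ((norm z)\<^sup>2 / 2))"
      unfolding exp_add[symmetric] by simp
    then show ?thesis
      by (simp add: std_normal_vec_density_def ennreal_mult[symmetric] mult_ac)
  qed
  have W: "emeasure (distr M borel ?W) B = K * emeasure ?L B" if [measurable]: "B \<in> sets borel" for B
  proof -
    have "emeasure (distr M borel ?W) B = (\<integral>\<^sup>+\<omega>. indicator B (?W \<omega>) \<partial>M)"
      by (subst nn_integral_indicator[symmetric], simp, subst nn_integral_distr) auto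
    also have "\<dots> = (\<integral>\<^sup>+x. indicator B ((1 / sqrt 2) *\<^sub>R (fst x - snd x)) \<partial>distr M (borel \<Otimes>\<^sub>M borel) (\<lambda>\<omega>. (V1 \<omega>, V2 \<omega>)))"
      by (subst nn_integral_distr) auto
    also have "distr M (borel \<Otimes>\<^sub>M borel) (\<lambda>\<omega>. (V1 \<omega>, V2 \<omega>)) = ?L \<Otimes>\<^sub>M ?L"
      using ind unfolding indep_var_distribution_eq D by simp
    also have "(\<integral>\<^sup>+x. indicator B ((1 / sqrt 2) *\<^sub>R (fst x - snd x)) \<partial>(?L \<Otimes>\<^sub>M ?L)) =
      (\<integral>\<^sup>+w. \<integral>\<^sup>+v. indicator B ((1 / sqrt 2) *\<^sub>R (v - w)) \<partial>?L \<partial>?L)"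
      by (subst LL.nn_integral_snd[symmetric]) auto
    also have "\<dots> = (\<integral>\<^sup>+w. ?p w * (\<integral>\<^sup>+v. ?p v * indicator B ((1 / sqrt 2) *\<^sub>R (v - w)) \<partial>lborel) \<partial>lborel)"
      by (simp add: nn_integral_density)
    also have "\<dots> = (\<integral>\<^sup>+w. ?p w * (ennreal (sqrt 2 ^ CARD('n)) *
        (\<integral>\<^sup>+z. ?p (w + sqrt 2 *\<^sub>R z) * indicator B z \<partial>lborel)) \<partial>lborel)"
    proof -
      \<comment> \<open>Substituting \<open>v = w + sqrt 2 *\<^sub>R z\<close> turns the argument of
        the indicator into \<open>z\<close>.\<close>
      have "(\<integral>\<^sup>+v. ?p v * indicator B ((1 / sqrt 2) *\<^sub>R (v - w)) \<partial>lborel) =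
        ennreal (sqrt 2 ^ CARD('n)) * (\<integral>\<^sup>+z. ?p (w + sqrt 2 *\<^sub>R z) * indicator B z \<partial>lborel)" for w
        by (subst nn_integral_lborel_affine[where c="sqrt 2" and t=w]) simp_all
      then show ?thesis by simp
    qed
    also have "\<dots> = (\<integral>\<^sup>+w. \<integral>\<^sup>+z. ennreal (sqrt 2 ^ CARD('n)) *
        (?p (w + sqrt 2 *\<^sub>R z) * ?p w) * indicator B z \<partial>lborel \<partial>lborel)"
      by (simp add: nn_integral_cmult[symmetric] mult_ac)
    also have "\<dots> = (\<integral>\<^sup>+z. \<integral>\<^sup>+w. ennreal (sqrt 2 ^ CARD('n)) *
        (?p (w + sqrt 2 *\<^sub>R z) * ?p w) * indicator B z \<partial>lborel \<partial>lborel)"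
      by (intro lborel_pair.Fubini') simp
    also have "\<dots> = (\<integral>\<^sup>+z. K * (?p z * indicator B z) \<partial>lborel)"
    proof (intro nn_integral_cong)
      fix z :: "real ^ 'n"
      have "(\<integral>\<^sup>+w. ennreal (sqrt 2 ^ CARD('n)) * (?p (w + sqrt 2 *\<^sub>R z) * ?p w) * indicator B z \<partial>lborel) =
        (\<integral>\<^sup>+w. (ennreal (sqrt 2 ^ CARD('n)) * (?p z * indicator B z)) *
          ennreal ((2 * pi) powr (- (real CARD('n) / 2)) * exp (- (norm ((1 / sqrt 2) *\<^sub>R z + 1 *\<^sub>R w))\<^sup>2)) \<partial>lborel)"
        unfolding sq by (simp only: mult_ac)
      also have "\<dots> = K * (?p z * indicator B z)"
        unfolding K_def
        by (subst nn_integral_lborel_affine[where c=1 and t="(1 / sqrt 2) *\<^sub>R z"])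
          (simp_all add: nn_integral_cmult mult_ac)
      finally show "(\<integral>\<^sup>+w. ennreal (sqrt 2 ^ CARD('n)) * (?p (w + sqrt 2 *\<^sub>R z) * ?p w) * indicator B z \<partial>lborel) =
        K * (?p z * indicator B z)" .
    qed
    also have "\<dots> = K * emeasure ?L B"
      by (simp add: nn_integral_cmult emeasure_density)
    finally show ?thesis .
  qed
  have "emeasure (distr M borel ?W) UNIV = 1"
    by (subst emeasure_distr) (auto simp: emeasure_space_1)
  then have "K = 1"
    using W[of UNIV] L.emeasure_space_1 by simp
  then show ?thesis
    by (intro measure_eqI) (auto simp: W)
qed

section \<open>Product structure of the standard normal law on vectors\<close>

lemma Basis_vec_eq_axis: "(Basis :: (real ^ 'n) set) = range (\<lambda>i. axis i 1)"
  by (auto simp: Basis_vec_def)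

lemma borel_measurable_vec_lambda [measurable]:
  "(\<lambda>f. (\<chi> i. f i) :: real ^ 'n) \<in> borel_measurable (\<Pi>\<^sub>M i\<in>UNIV. borel)"
  by (subst borel_measurable_euclidean_space) (auto simp: Basis_vec_eq_axis inner_axis)

text \<open>Lebesgue measure is determined by its values on open boxes, and a box pulls back to a
  product of intervals. This lets vectors inherit the independence of product coordinates.\<close>

lemma lborel_vec_eq_PiM:
  "distr (\<Pi>\<^sub>M i\<in>UNIV. lborel) borel (\<lambda>f. (\<chi> i. f i) :: real ^ 'n) = lborel"
proof (rule lborel_eqI[symmetric])
  interpret product_sigma_finite "\<lambda>_::'n. lborel :: real measure" ..
  have m[measurable]: "(\<lambda>f. (\<chi> i. f i) :: real ^ 'n) \<in> borel_measurable (\<Pi>\<^sub>M i\<in>UNIV. lborel)"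
    using borel_measurable_vec_lambda by (simp cong: measurable_cong_sets sets_PiM_cong)
  fix l u :: "real ^ 'n"
  assume le: "\<And>b. b \<in> Basis \<Longrightarrow> l \<bullet> b \<le> u \<bullet> b"
  then have le': "l $ i \<le> u $ i" for i
    using le[of "axis i 1"] by (simp add: Basis_vec_eq_axis inner_axis)
  have "emeasure (distr (\<Pi>\<^sub>M i\<in>UNIV. lborel) borel (\<lambda>f. (\<chi> i. f i) :: real ^ 'n)) (box l u) =
    emeasure (\<Pi>\<^sub>M i\<in>UNIV. lborel) (\<Pi>\<^sub>E i\<in>UNIV. {l $ i <..< u $ i})"
    by (subst emeasure_distr) (auto simp: mem_box_cart space_PiM PiE_iff intro!: arg_cong2[where f=emeasure])
  also have "\<dots> = (\<Prod>i\<in>UNIV. ennreal (u $ i - l $ i))"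
    using le' by (subst emeasure_PiM) auto
  also have "\<dots> = ennreal (\<Prod>b\<in>Basis. (u - l) \<bullet> b)"
    using le' unfolding Basis_vec_eq_axis
    by (subst prod.reindex) (auto simp: inj_on_def axis_eq_axis inner_axis prod_ennreal)
  finally show "emeasure (distr (\<Pi>\<^sub>M i\<in>UNIV. lborel) borel (\<lambda>f. (\<chi> i. f i) :: real ^ 'n)) (box l u) =
    ennreal (\<Prod>b\<in>Basis. (u - l) \<bullet> b)" .
qed simp

text \<open>A product measure is determined by its values on measurable rectangles. There the
  indicator is a product as well, and the integral of a product of one-variable functions
  factors.\<close>

lemma (in product_sigma_finite) density_PiM:
  assumes I: "finite I" and f[measurable]: "\<And>i. i \<in> I \<Longrightarrow> f i \<in> borel_measurable (M i)"
    and sf: "\<And>i. sigma_finite_measure (density (M i) (f i))"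
  shows "density (\<Pi>\<^sub>M i\<in>I. M i) (\<lambda>x. \<Prod>i\<in>I. f i (x i)) = (\<Pi>\<^sub>M i\<in>I. density (M i) (f i))"
proof -
  interpret D: product_sigma_finite "\<lambda>i. density (M i) (f i)"
    using sf by (simp add: product_sigma_finite_def)
  show ?thesis
  proof (rule D.PiM_eqI[OF I])
    show "sets (density (\<Pi>\<^sub>M i\<in>I. M i) (\<lambda>x. \<Prod>i\<in>I. f i (x i))) = sets (\<Pi>\<^sub>M i\<in>I. density (M i) (f i))"
      by (auto intro!: sets_PiM_cong)
    fix A assume A: "\<And>i. i \<in> I \<Longrightarrow> A i \<in> sets (density (M i) (f i))"
    then have A'[measurable]: "\<And>i. i \<in> I \<Longrightarrow> A i \<in> sets (M i)" by simp
    have [measurable]: "(\<lambda>x. \<Prod>i\<in>I. f i (x i)) \<in> borel_measurable (\<Pi>\<^sub>M i\<in>I. M i)"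
    proof (intro borel_measurable_prod_ennreal)
      fix i assume i: "i \<in> I"
      show "(\<lambda>x. f i (x i)) \<in> borel_measurable (\<Pi>\<^sub>M i\<in>I. M i)"
        by (rule measurable_compose[where f="\<lambda>x. x i" and g="f i", OF measurable_component_singleton[OF i, of M] f[OF i]])
    qed
    have "emeasure (density (\<Pi>\<^sub>M i\<in>I. M i) (\<lambda>x. \<Prod>i\<in>I. f i (x i))) (Pi\<^sub>E I A) =
      (\<integral>\<^sup>+x. (\<Prod>i\<in>I. f i (x i)) * indicator (Pi\<^sub>E I A) x \<partial>(\<Pi>\<^sub>M i\<in>I. M i))"
      using I by (intro emeasure_density) (auto intro!: sets_PiM_I_finite)
    also have "\<dots> = (\<integral>\<^sup>+x. (\<Prod>i\<in>I. f i (x i) * indicator (A i) (x i)) \<partial>(\<Pi>\<^sub>M i\<in>I. M i))"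
    proof (intro nn_integral_cong)
      fix x assume "x \<in> space (\<Pi>\<^sub>M i\<in>I. M i)"
      then have "indicator (Pi\<^sub>E I A) x = (\<Prod>i\<in>I. indicator (A i) (x i) :: ennreal)"
        using I by (auto simp: indicator_def space_PiM PiE_iff)
      then show "(\<Prod>i\<in>I. f i (x i)) * indicator (Pi\<^sub>E I A) x = (\<Prod>i\<in>I. f i (x i) * indicator (A i) (x i))"
        by (simp add: prod.distrib)
    qed
    also have "\<dots> = (\<Prod>i\<in>I. \<integral>\<^sup>+x. f i x * indicator (A i) x \<partial>M i)"
      by (rule product_nn_integral_prod[OF I]) simp
    also have "\<dots> = (\<Prod>i\<in>I. emeasure (density (M i) (f i)) (A i))"
      by (intro prod.cong refl emeasure_density[symmetric]) auto
    finally show "emeasure (density (\<Pi>\<^sub>M i\<in>I. M i) (\<lambda>x. \<Prod>i\<in>I. f i (x i))) (Pi\<^sub>E I A) =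
      (\<Prod>i\<in>I. emeasure (density (M i) (f i)) (A i))" .
  qed
qed

lemma std_normal_vec_density_eq_prod:
  "std_normal_vec_density (x :: real ^ 'n) = (\<Prod>i\<in>UNIV. std_normal_density (x $ i))"
proof -
  have "(norm x)\<^sup>2 = (\<Sum>i\<in>UNIV. (x $ i)\<^sup>2)"
    unfolding norm_vec_def L2_set_def by (simp add: sum_nonneg)
  moreover have "(1 / sqrt (2 * pi)) ^ CARD('n) = (2 * pi) powr (- (real CARD('n) / 2))"
    by (simp add: powr_minus powr_half_sqrt[symmetric] powr_powr powr_realpow[symmetric] power_divide
        inverse_eq_divide)
  ultimately show ?thesis
    unfolding std_normal_vec_density_def std_normal_density_def prod.distrib
    by (simp add: exp_sum[symmetric] sum_divide_distrib sum_negf)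
qed

text \<open>The density factors over the coordinates, so it can be moved to the product side and
  absorbed into the factors. Independence of the coordinates is thereby available.\<close>

lemma std_normal_vec_density_eq_PiM:
  "density lborel (\<lambda>x::real ^ 'n. ennreal (std_normal_vec_density x)) =
    distr (\<Pi>\<^sub>M i\<in>UNIV. density lborel (\<lambda>x. ennreal (std_normal_density x))) borel (\<lambda>f. \<chi> i. f i)"
proof -
  interpret product_sigma_finite "\<lambda>_::'n. lborel :: real measure" ..
  interpret N: prob_space "density lborel (\<lambda>x. ennreal (std_normal_density x))"
    by (rule prob_space_normal_density) simp
  have m[measurable]: "(\<lambda>f. (\<chi> i. f i) :: real ^ 'n) \<in> borel_measurable (\<Pi>\<^sub>M i\<in>UNIV. lborel)"
    using borel_measurable_vec_lambda by (simp cong: measurable_cong_sets sets_PiM_cong)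
  have "density lborel (\<lambda>x::real ^ 'n. ennreal (std_normal_vec_density x)) =
    density (distr (\<Pi>\<^sub>M i\<in>UNIV. lborel) borel (\<lambda>f. \<chi> i. f i)) (\<lambda>x. ennreal (std_normal_vec_density x))"
    by (simp only: lborel_vec_eq_PiM)
  also have "\<dots> = distr (density (\<Pi>\<^sub>M i\<in>UNIV. lborel)
      (\<lambda>f. \<Prod>i\<in>UNIV. ennreal (std_normal_density (f i)))) borel (\<lambda>f. \<chi> i. f i)"
    by (subst density_distr) (auto simp: std_normal_vec_density_eq_prod prod_ennreal)
  also have "density (\<Pi>\<^sub>M i\<in>(UNIV::'n set). lborel) (\<lambda>f. \<Prod>i\<in>UNIV. ennreal (std_normal_density (f i))) =
      (\<Pi>\<^sub>M i\<in>UNIV. density lborel (\<lambda>x. ennreal (std_normal_density x)))"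
    by (rule density_PiM) (auto intro: N.sigma_finite_measure_axioms)
  finally show ?thesis .
qed

section \<open>Gaussian measure of cones\<close>

text \<open>For \<open>c \<ge> 0\<close> this is the two-sided cone about the axis \<open>k\<close>
  with \<open>c\<close> the squared tangent of the half-angle.\<close>

definition double_cone :: "'n::finite \<Rightarrow> real \<Rightarrow> (real ^ 'n) set" where
  "double_cone k c = {z. (\<Sum>i\<in>UNIV - {k}. (z $ i)\<^sup>2) \<le> c * (z $ k)\<^sup>2}"

definition half_cone :: "'n::finite \<Rightarrow> real \<Rightarrow> (real ^ 'n) set" where
  "half_cone k c = {z \<in> double_cone k c. 0 < z $ k}"

lemma borel_measurable_vec_nth [measurable]: "(\<lambda>z::real ^ 'n. z $ i) \<in> borel_measurable borel"
  by (intro borel_measurable_continuous_onI continuous_intros)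

lemma sets_cone [measurable]:
  "double_cone k c \<in> sets borel" "half_cone k c \<in> sets borel"
  unfolding half_cone_def double_cone_def by measurable

text \<open>The coordinate \<open>k\<close> has a density, so it hits \<open>0\<close> with
  probability \<open>0\<close>. This permits dividing by its square and splitting the double cone
  into two halves.\<close>

lemma AE_std_normal_vec_density_nth:
  "AE z in density lborel (\<lambda>x::real ^ 'n. ennreal (std_normal_vec_density x)). z $ k \<noteq> 0"
proof -
  let ?P = "\<Pi>\<^sub>M i\<in>(UNIV :: 'n set). density lborel (\<lambda>x. ennreal (std_normal_density x))"
  have D: "distributed ?P lborel (\<lambda>f. f k) std_normal_density"
    by (rule PiM_std_normal(3)) auto
  have "AE x in distr ?P lborel (\<lambda>f. f k). x \<noteq> 0"
    unfolding distributed_distr_eq_density[OF D]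
    by (subst AE_density) (auto intro: eventually_mono[OF AE_lborel_singleton[of 0]])
  then have "AE f in ?P. f k \<noteq> 0"
    using distributed_measurable[OF D] by (subst (asm) AE_distr_iff) auto
  moreover have "(\<lambda>f. (\<chi> i. f i) :: real ^ 'n) \<in> borel_measurable ?P"
    using borel_measurable_vec_lambda by (simp cong: measurable_cong_sets sets_PiM_cong)
  ultimately show ?thesis
    unfolding std_normal_vec_density_eq_PiM by (subst AE_distr_iff) auto
qed

text \<open>Dividing the cone condition by the squared coordinate \<open>k\<close> gives a bound on
  a ratio of independent chi-squared variables; the factor \<open>1 / real m\<close> is the
  normalisation of the numerator in \<open>F_distribution\<close>.\<close>

lemma measure_double_cone:
  fixes k :: "'n::finite"
  assumes m: "m = CARD('n) - 1" "0 < m"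
  shows "measure (density lborel (\<lambda>x. ennreal (std_normal_vec_density x))) (double_cone k c) =
    cdf (F_distribution m 1) (1 / real m * c)"
proof -
  let ?N = "density lborel (\<lambda>x. ennreal (std_normal_density x))"
  define P where "P = (\<Pi>\<^sub>M i\<in>(UNIV :: 'n set). ?N)"
  interpret P: prob_space P unfolding P_def by (rule PiM_std_normal) auto
  have ind: "P.indep_vars (\<lambda>_. borel) (\<lambda>i f. f i) UNIV"
    and D: "distributed P lborel (\<lambda>f. f i) std_normal_density" for i
    unfolding P_def by (rule PiM_std_normal; simp)+
  have [measurable]: "(\<lambda>f. f i) \<in> borel_measurable P" for i
    using distributed_measurable[OF D] by simp
  have vec[measurable]: "(\<lambda>f. (\<chi> i. f i) :: real ^ 'n) \<in> borel_measurable P"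
    using borel_measurable_vec_lambda by (simp add: P_def cong: measurable_cong_sets sets_PiM_cong)
  define X where "X f = (\<Sum>i\<in>UNIV - {k}. (f i)\<^sup>2)" for f :: "'n \<Rightarrow> real"
  define Y where "Y f = (f k)\<^sup>2" for f :: "'n \<Rightarrow> real"
  have [measurable]: "X \<in> borel_measurable P" "Y \<in> borel_measurable P"
    unfolding X_def[abs_def] Y_def[abs_def] by measurable
  have card: "card (UNIV - {k}) = m" using m by (simp add: card_Diff_subset)
  then have ne: "UNIV - {k} \<noteq> {}" using m by force
  have ind': "P.indep_vars (\<lambda>_. borel) (\<lambda>i f. f i) (UNIV - {k})"
    using ind by (rule P.indep_vars_subset) auto
  have "distributed P lborel X (chi_squared_density (real m / 2))"
    using P.distributed_sum_squares_std_normal[OF _ ne ind' D] unfolding X_def[abs_def] card by simp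
  then have X: "distr P borel X = chi_squared_distribution m"
    using m by (simp add: chi_squared_distribution_eq_density distributed_def cong: distr_cong)
  have "distributed P lborel Y (chi_squared_density (1 / 2))"
    using P.distributed_square_std_normal[OF D] unfolding Y_def[abs_def] by simp
  then have Y: "distr P borel Y = chi_squared_distribution 1"
    by (simp add: chi_squared_distribution_eq_density distributed_def cong: distr_cong)
  \<comment> \<open>\<open>X\<close> and \<open>Y\<close> depend on disjoint blocks of coordinates;
    the restrictions express this in the form in which independence of blocks is available.\<close>
  have "P.indep_var borel ((\<lambda>f. \<Sum>i\<in>UNIV - {k}. (f i)\<^sup>2) \<circ> (\<lambda>\<omega>. restrict (\<lambda>i. \<omega> i) (UNIV - {k})))
     borel ((\<lambda>f. (f k)\<^sup>2) \<circ> (\<lambda>\<omega>. restrict (\<lambda>i. \<omega> i) {k}))"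
    by (intro P.indep_var_compose[OF P.indep_var_restrict[OF ind]]) auto
  also have "(\<lambda>f. \<Sum>i\<in>UNIV - {k}. (f i)\<^sup>2) \<circ> (\<lambda>\<omega>. restrict (\<lambda>i. \<omega> i) (UNIV - {k})) = X"
    by (auto simp: X_def fun_eq_iff)
  also have "(\<lambda>f. (f k)\<^sup>2) \<circ> (\<lambda>\<omega>. restrict (\<lambda>i. \<omega> i) {k}) = Y"
    by (auto simp: Y_def fun_eq_iff)
  finally have XY: "chi_squared_distribution m \<Otimes>\<^sub>M chi_squared_distribution 1 =
      distr P (borel \<Otimes>\<^sub>M borel) (\<lambda>f. (X f, Y f))"
    unfolding P.indep_var_distribution_eq X Y by simp
  have nz: "AE f in P. f k \<noteq> 0"
    using AE_std_normal_vec_density_nth[of k] unfolding std_normal_vec_density_eq_PiM P_def[symmetric]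
    by (subst (asm) AE_distr_iff) auto
  have "measure (density lborel (\<lambda>x. ennreal (std_normal_vec_density x))) (double_cone k c) =
    P.prob {f \<in> space P. X f \<le> c * Y f}"
    unfolding std_normal_vec_density_eq_PiM P_def[symmetric]
    by (subst measure_distr) (auto simp: double_cone_def X_def Y_def intro!: arg_cong[where f=P.prob])
  \<comment> \<open>Where \<open>Y f = 0\<close> the quotient is \<open>0\<close> by convention and
    the two events may disagree, so they are only compared almost everywhere.\<close>
  also have "\<dots> = P.prob {f \<in> space P. (X f / real m) / (Y f / real 1) \<le> 1 / real m * c}"
  proof (rule P.finite_measure_eq_AE)
    show "AE f in P. f \<in> {f \<in> space P. X f \<le> c * Y f} \<longleftrightarrow>
        f \<in> {f \<in> space P. (X f / real m) / (Y f / real 1) \<le> 1 / real m * c}"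
      using nz
    proof eventually_elim
      case (elim f)
      then have "0 < Y f" by (simp add: Y_def)
      then show ?case using m(2) by (simp add: field_simps)
    qed
  qed measurable
  also have "\<dots> = cdf (F_distribution m 1) (1 / real m * c)"
    unfolding F_distribution_def XY cdf_def
    by (subst distr_distr) (auto simp: measure_distr intro!: arg_cong[where f=P.prob])
  finally show ?thesis .
qed

text \<open>The map \<open>z\<close> to \<open>- z\<close> preserves the density and exchanges the
  two halves of the double cone, which together fill it up to the null set
  \<open>z $ k = 0\<close>.\<close>

lemma measure_half_cone:
  fixes k :: "'n::finite"
  assumes L: "prob_space (density lborel (\<lambda>x :: real ^ 'n. ennreal (std_normal_vec_density x)))" (is "prob_space ?L")
  shows "measure ?L (half_cone k c) = measure ?L (double_cone k c) / 2"
proof -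
  interpret prob_space ?L by fact
  define H' where "H' = {z \<in> double_cone k c. z $ k < 0}"
  have [measurable]: "H' \<in> sets borel"
    unfolding H'_def double_cone_def by measurable
  have "emeasure ?L (half_cone k c) =
    (\<integral>\<^sup>+z. ennreal (std_normal_vec_density (0 + (- 1) *\<^sub>R z)) * indicator (half_cone k c) (0 + (- 1) *\<^sub>R z) \<partial>lborel)"
    by (subst emeasure_density, simp, simp, subst nn_integral_lborel_affine[where c="-1" and t=0]) auto
  also have "\<dots> = emeasure ?L H'"
    by (subst emeasure_density)
      (auto simp: H'_def half_cone_def double_cone_def std_normal_vec_density_def indicator_def
        intro!: nn_integral_cong)
  finally have reflect: "measure ?L (half_cone k c) = measure ?L H'"
    by (simp add: measure_def)
  have "measure ?L (double_cone k c) = measure ?L (half_cone k c \<union> H')"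
  proof (rule finite_measure_eq_AE)
    show "AE z in ?L. z \<in> double_cone k c \<longleftrightarrow> z \<in> half_cone k c \<union> H'"
      using AE_std_normal_vec_density_nth[of k]
      by eventually_elim (auto simp: half_cone_def H'_def)
  qed auto
  also have "\<dots> = measure ?L (half_cone k c) + measure ?L H'"
    by (rule finite_measure_Union) (auto simp: half_cone_def H'_def)
  finally show ?thesis using reflect by simp
qed

section \<open>Collisions\<close>

text \<open>Seen from the origin, the ball of radius \<open>2 * r\<close> about
  \<open>axis k 2\<close> fills the cone whose half-angle has sine \<open>r\<close>, hence squared
  tangent \<open>r\<^sup>2 / (1 - r\<^sup>2)\<close>. The proof is algebraic, with \<open>x\<close>
  the component of \<open>w\<close> along the axis and \<open>S\<close> the squared norm of the
  rest.\<close>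

lemma line_meets_ball_iff:
  fixes w :: "real ^ 'n"
  assumes r: "0 < r" "r < 1"
  shows "(\<exists>t\<ge>0. norm (axis k 2 - t *\<^sub>R w) \<le> 2 * r) \<longleftrightarrow> w \<in> half_cone k (r\<^sup>2 / (1 - r\<^sup>2))"
proof -
  define S where "S = (\<Sum>i\<in>UNIV - {k}. (w $ i)\<^sup>2)"
  define x where "x = w $ k"
  have S: "0 \<le> S" by (simp add: S_def sum_nonneg)
  have r2: "r\<^sup>2 < 1" "0 < r\<^sup>2" using r by (auto simp: power_less_one_iff)
  have nrm: "(norm (axis k 2 - t *\<^sub>R w))\<^sup>2 = (2 - t * x)\<^sup>2 + t\<^sup>2 * S" for t
  proof -
    have "(norm (axis k 2 - t *\<^sub>R w))\<^sup>2 = (\<Sum>i\<in>UNIV. ((axis k 2 - t *\<^sub>R w) $ i)\<^sup>2)"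
      unfolding norm_vec_def L2_set_def by (simp add: sum_nonneg)
    also have "\<dots> = ((axis k 2 - t *\<^sub>R w) $ k)\<^sup>2 + (\<Sum>i\<in>UNIV - {k}. ((axis k 2 - t *\<^sub>R w) $ i)\<^sup>2)"
      by (rule sum.remove) auto
    also have "(\<Sum>i\<in>UNIV - {k}. ((axis k 2 - t *\<^sub>R w) $ i)\<^sup>2) = t\<^sup>2 * S"
      unfolding S_def sum_distrib_left by (intro sum.cong) (auto simp: axis_def power_mult_distrib)
    finally show ?thesis by (simp add: x_def axis_def)
  qed
  have le: "norm (axis k 2 - t *\<^sub>R w) \<le> 2 * r \<longleftrightarrow> (2 - t * x)\<^sup>2 + t\<^sup>2 * S \<le> (2 * r)\<^sup>2" for t
    unfolding nrm[symmetric] by (rule power_mono_iff[symmetric]) (use r in auto)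
  have cone: "w \<in> half_cone k (r\<^sup>2 / (1 - r\<^sup>2)) \<longleftrightarrow> 0 < x \<and> S * (1 - r\<^sup>2) \<le> r\<^sup>2 * x\<^sup>2"
    using r2 by (auto simp: half_cone_def double_cone_def S_def x_def field_simps)
  show ?thesis unfolding le cone
  proof safe
    fix t assume t: "0 \<le> t" and *: "(2 - t * x)\<^sup>2 + t\<^sup>2 * S \<le> (2 * r)\<^sup>2"
    \<comment> \<open>The initial distance \<open>2\<close> exceeds \<open>2 * r\<close>, so the
      motion must approach the ball: this forces both \<open>0 < x\<close> and
      \<open>t \<noteq> 0\<close>.\<close>
    have lt: "(2 - t * x)\<^sup>2 < 4"
      using * r2 S by (smt (verit) four_x_squared mult_nonneg_nonneg zero_le_power2)
    show x: "0 < x"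
    proof (rule ccontr)
      assume "\<not> 0 < x"
      then have "2 \<le> 2 - t * x" using t by (simp add: mult_nonneg_nonpos)
      then have "2\<^sup>2 \<le> (2 - t * x)\<^sup>2" by (intro power_mono) auto
      then show False using lt by simp
    qed
    have "t \<noteq> 0" using lt by auto
    define y where "y = t * x"
    have "t\<^sup>2 * (S * (1 - r\<^sup>2)) = (t\<^sup>2 * S) * (1 - r\<^sup>2)" by simp
    also have "\<dots> \<le> ((2 * r)\<^sup>2 - (2 - y)\<^sup>2) * (1 - r\<^sup>2)"
      using * r2 by (intro mult_right_mono) (auto simp: y_def)
    \<comment> \<open>Completing the square in \<open>y\<close>; dropping the square gives the cone
      condition. It vanishes at \<open>y = 2 * (1 - r\<^sup>2)\<close>, the value chosen for
      \<open>t * x\<close> in the converse.\<close>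
    also have "\<dots> = r\<^sup>2 * y\<^sup>2 - (y - 2 * (1 - r\<^sup>2))\<^sup>2"
      by (simp add: power2_eq_square algebra_simps)
    also have "\<dots> \<le> t\<^sup>2 * (r\<^sup>2 * x\<^sup>2)" by (simp add: y_def power_mult_distrib)
    finally show "S * (1 - r\<^sup>2) \<le> r\<^sup>2 * x\<^sup>2"
      using \<open>t \<noteq> 0\<close> by simp
  next
    assume x: "0 < x" and *: "S * (1 - r\<^sup>2) \<le> r\<^sup>2 * x\<^sup>2"
    \<comment> \<open>the time at which the relative motion touches the ball when \<open>w\<close> is on the boundary of the cone\<close>
    define t where "t = 2 * (1 - r\<^sup>2) / x"
    have tx: "t * x = 2 * (1 - r\<^sup>2)" and t: "0 \<le> t" using x r2 by (auto simp: t_def)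
    have "t\<^sup>2 * S * (1 - r\<^sup>2) \<le> t\<^sup>2 * (r\<^sup>2 * x\<^sup>2)"
      using mult_left_mono[OF *, of "t\<^sup>2"] by (simp add: mult.assoc)
    also have "\<dots> = r\<^sup>2 * (t * x)\<^sup>2" by (simp add: power_mult_distrib)
    also have "\<dots> = 4 * r\<^sup>2 * (1 - r\<^sup>2) * (1 - r\<^sup>2)" unfolding tx by (simp add: power2_eq_square algebra_simps)
    finally have "t\<^sup>2 * S \<le> 4 * r\<^sup>2 * (1 - r\<^sup>2)" using r2 by simp
    then have "(2 - t * x)\<^sup>2 + t\<^sup>2 * S \<le> (2 * r)\<^sup>2"
      unfolding tx by (simp add: power2_eq_square algebra_simps)
    then show "\<exists>t\<ge>0. (2 - t * x)\<^sup>2 + t\<^sup>2 * S \<le> (2 * r)\<^sup>2" using t by blast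
  qed
qed

lemma cball_Int_cball_nonempty_iff:
  fixes a b :: "'a::euclidean_space"
  assumes "0 \<le> r"
  shows "cball a r \<inter> cball b r \<noteq> {} \<longleftrightarrow> dist a b \<le> 2 * r"
proof
  assume "cball a r \<inter> cball b r \<noteq> {}"
  then obtain c where "dist a c \<le> r" "dist b c \<le> r" by auto
  then show "dist a b \<le> 2 * r" using dist_triangle2[of a b c] by linarith
next
  assume "dist a b \<le> 2 * r"
  then have "midpoint a b \<in> cball a r \<inter> cball b r"
    by (simp add: dist_midpoint)
  then show "cball a r \<inter> cball b r \<noteq> {}" by blast
qed

lemma translate_set_cball: "translate_set (cball a r) v s = cball (a + s *\<^sub>R v) r"
proof (rule set_eqI)
  fix y
  have "y \<in> translate_set (cball a r) v s \<longleftrightarrow> y - s *\<^sub>R v \<in> cball a r"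
    unfolding translate_set_def by (auto simp: image_iff intro!: bexI[of _ "y - s *\<^sub>R v"])
  then show "y \<in> translate_set (cball a r) v s \<longleftrightarrow> y \<in> cball (a + s *\<^sub>R v) r"
    by (simp add: dist_norm algebra_simps)
qed

text \<open>Two balls of radius \<open>r\<close> meet iff their centres are within
  \<open>2 * r\<close>, and the difference of the moving centres is
  \<open>axis k 2 - t *\<^sub>R (v1 - v2)\<close>.\<close>

lemma collision_time_balls_finite_iff:
  fixes v1 v2 :: "real ^ 'n"
  assumes r: "0 < r" "r < 1"
  shows "collision_time (cball (axis k (- 1)) r) (cball (axis k 1) r) v1 v2 < \<infinity> \<longleftrightarrow>
    v1 - v2 \<in> half_cone k (r\<^sup>2 / (1 - r\<^sup>2))"
proof -
  have "(axis k 1 :: real ^ 'n) = axis k (- 1) + axis k 2"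
    by (auto simp: axis_def vec_eq_iff)
  then have "dist (axis k (- 1) + t *\<^sub>R v1) (axis k 1 + t *\<^sub>R v2) = norm (axis k 2 - t *\<^sub>R (v1 - v2))" for t
    by (subst dist_commute) (simp add: dist_norm algebra_simps)
  then show ?thesis
    using r unfolding collision_time_finite_iff translate_set_cball line_meets_ball_iff[OF r, symmetric]
    by (simp add: cball_Int_cball_nonempty_iff)
qed

text \<open>Both sides of the cone condition are quadratic. The invariance allows the factor
  \<open>1 / sqrt 2\<close> that makes the velocity difference standard normal.\<close>

lemma scaleR_in_half_cone_iff:
  assumes "0 < a"
  shows "a *\<^sub>R z \<in> half_cone k c \<longleftrightarrow> z \<in> half_cone k c"
proof -
  have "(\<Sum>i\<in>UNIV - {k}. (a * z $ i)\<^sup>2) = a\<^sup>2 * (\<Sum>i\<in>UNIV - {k}. (z $ i)\<^sup>2)"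
    "c * (a * z $ k)\<^sup>2 = a\<^sup>2 * (c * (z $ k)\<^sup>2)"
    by (simp_all add: sum_distrib_left power_mult_distrib)
  moreover have "a\<^sup>2 * x \<le> a\<^sup>2 * y \<longleftrightarrow> x \<le> y" for x y
    using assms by (intro mult_le_cancel_left_pos) simp
  ultimately have "(\<Sum>i\<in>UNIV - {k}. (a * z $ i)\<^sup>2) \<le> c * (a * z $ k)\<^sup>2 \<longleftrightarrow>
      (\<Sum>i\<in>UNIV - {k}. (z $ i)\<^sup>2) \<le> c * (z $ k)\<^sup>2"
    by (simp only:)
  then show ?thesis
    using assms by (simp add: half_cone_def double_cone_def zero_less_mult_iff)
qed

lemma (in prob_space) collision_prob_eq_cdf:
  fixes V1 V2 :: "'a \<Rightarrow> real ^ 'n" and k :: 'n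
  assumes r: "0 < r" "r < 1" and m: "m = CARD('n) - 1" "0 < m"
    and V1: "standard_normal_vector M V1" and V2: "standard_normal_vector M V2"
    and ind: "indep_var borel V1 borel V2"
  shows "collision_prob M k V1 V2 r = 1 / 2 * cdf (F_distribution m 1) (1 / real m * (r\<^sup>2 / (1 - r\<^sup>2)))"
proof -
  note [measurable] = standard_normal_vector_distr(1)[OF V1] standard_normal_vector_distr(1)[OF V2]
  let ?L = "density lborel (\<lambda>x::real ^ 'n. ennreal (std_normal_vec_density x))"
  have L: "prob_space ?L"
    unfolding standard_normal_vector_distr(2)[OF V1, symmetric] by (rule prob_space_distr) simp
  have "collision_prob M k V1 V2 r =
    prob {\<omega> \<in> space M. (1 / sqrt 2) *\<^sub>R (V1 \<omega> - V2 \<omega>) \<in> half_cone k (r\<^sup>2 / (1 - r\<^sup>2))}"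
    unfolding collision_prob_def
    by (subst scaleR_in_half_cone_iff, simp, simp only: collision_time_balls_finite_iff[OF r])
  also have "\<dots> = measure (distr M borel (\<lambda>\<omega>. (1 / sqrt 2) *\<^sub>R (V1 \<omega> - V2 \<omega>))) (half_cone k (r\<^sup>2 / (1 - r\<^sup>2)))"
    by (subst measure_distr) (auto intro!: arg_cong[where f=prob])
  also have "\<dots> = measure ?L (double_cone k (r\<^sup>2 / (1 - r\<^sup>2))) / 2"
    unfolding distr_diff_standard_normal_vector[OF V1 V2 ind] by (rule measure_half_cone[OF L])
  finally show ?thesis
    unfolding measure_double_cone[OF m] by simp
qed

section \<open>Asymptotics for small radius\<close>

text \<open>The range \<open>- 1 < a\<close> includes the exponent \<open>- 1 / 2\<close>, unbounded
  near \<open>0\<close>, which occurs for \<open>m = 1\<close>.\<close>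

lemma has_bochner_integral_powr_Icc:
  fixes a q :: real
  assumes a: "- 1 < a" and q: "0 \<le> q"
  shows "has_bochner_integral lborel (\<lambda>x. indicator {0..q} x *\<^sub>R (x powr a)) (q powr (a + 1) / (a + 1))"
proof (rule has_bochner_integral_nn_integral)
  have "(\<integral>\<^sup>+x. ennreal (x powr a) * indicator {0..q} x \<partial>lborel) = ennreal (q powr (a + 1) / (a + 1))"
    by (rule nn_integral_has_integral_lebesgue'[OF _ has_integral_powr_from_0]) (use a q in auto)
  also have "(\<integral>\<^sup>+x. ennreal (x powr a) * indicator {0..q} x \<partial>lborel) =
      (\<integral>\<^sup>+x. ennreal (indicator {0..q} x *\<^sub>R (x powr a)) \<partial>lborel)"
    by (intro nn_integral_cong) (simp add: indicator_def)
  finally show "(\<integral>\<^sup>+x. ennreal (indicator {0..q} x *\<^sub>R (x powr a)) \<partial>lborel) = ennreal (q powr (a + 1) / (a + 1))" .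
qed (use a in auto)

text \<open>On \<open>{0..q}\<close> the last factor of the density decreases from \<open>1\<close>
  to its value at \<open>q\<close>; replacing it by either extreme leaves a pure power integral. The
  leading \<open>2\<close> cancels against the \<open>1 / 2\<close> in the collision
  probability.\<close>

lemma F_density_integral_bounds:
  fixes m :: nat and r :: real
  assumes m: "0 < m" and r: "0 < r" "r < 1"
  defines "A \<equiv> Gamma ((real m + 1) / 2) / (Gamma (real m / 2) * sqrt pi)"
    and "q \<equiv> 1 / real m * (r\<^sup>2 / (1 - r\<^sup>2))"
  shows "2 * (1 / real m * A * r ^ m * sqrt (1 - r\<^sup>2)) \<le> (LBINT x:{0..q}. F_density m x)"
    and "(LBINT x:{0..q}. F_density m x) \<le> 2 * (1 / real m * A * r ^ m * (1 - r\<^sup>2) powr (- (real m / 2)))"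
proof -
  have r2: "r\<^sup>2 < 1" "0 < r\<^sup>2" using r by (auto simp: power_less_one_iff)
  have q: "0 \<le> q" using r2 by (auto simp: q_def)
  have A: "0 < A" using m by (simp add: A_def Gamma_real_pos)
  \<comment> \<open>The value of the decreasing factor at \<open>x = q\<close>, since
    \<open>1 + real m * q = 1 / (1 - r\<^sup>2)\<close>.\<close>
  define s where "s = (1 - r\<^sup>2) powr ((real m + 1) / 2)"
  define B where "B = A * real m powr (real m / 2)"
  have B: "0 \<le> B" using A by (simp add: B_def)
  define J where "J = q powr (real m / 2) / (real m / 2)"
  have J: "has_bochner_integral lborel (\<lambda>x. indicator {0..q} x *\<^sub>R (x powr (real m / 2 - 1))) J"
    using has_bochner_integral_powr_Icc[of "real m / 2 - 1" q] m q by (simp add: J_def)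
  have cJ: "has_bochner_integral lborel (\<lambda>x. indicator {0..q} x *\<^sub>R (c * x powr (real m / 2 - 1))) (c * J)" for c
    using has_bochner_integral_mult_right[OF J, of c] by (simp add: mult.left_commute)
  have int: "set_integrable lborel {0..q} (\<lambda>x. c * x powr (real m / 2 - 1))" for c
    unfolding set_integrable_def by (rule integrable.intros[OF cJ])
  have val: "(LBINT x:{0..q}. c * x powr (real m / 2 - 1)) = c * J" for c
    unfolding set_lebesgue_integral_def by (rule has_bochner_integral_integral_eq[OF cJ])
  have q1: "1 + real m * q = 1 / (1 - r\<^sup>2)"
    using m r2 by (simp add: q_def field_simps)
  have lower: "B * s * x powr (real m / 2 - 1) \<le> F_density m x"
    and upper: "F_density m x \<le> B * x powr (real m / 2 - 1)" if x: "x \<in> {0..q}" for x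
  proof -
    define t where "t = (1 + real m * x) powr (- ((real m + 1) / 2))"
    have F: "F_density m x = B * t * x powr (real m / 2 - 1)"
      by (simp add: F_density_def A_def B_def t_def)
    have "t \<le> 1 powr (- ((real m + 1) / 2))"
      unfolding t_def using x by (intro powr_mono2') auto
    then have "t \<le> 1" by simp
    then show "F_density m x \<le> B * x powr (real m / 2 - 1)"
      unfolding F using B by (intro mult_right_mono) (auto simp: mult_left_le)
    have "(1 + real m * q) powr (- ((real m + 1) / 2)) \<le> t"
      unfolding t_def using x m by (intro powr_mono2') (auto simp: add_pos_nonneg)
    then have "s \<le> t"
      unfolding q1 s_def using r2 by (simp add: powr_divide powr_minus_divide)
    then show "B * s * x powr (real m / 2 - 1) \<le> F_density m x"
      unfolding F using B by (intro mult_right_mono mult_left_mono) auto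
  qed
  have F: "set_integrable lborel {0..q} (F_density m)"
    by (rule set_integrable_bound[OF int[of B]])
      (use upper F_density_nonneg[OF m] in \<open>auto simp: set_borel_measurable_def intro!: AE_I2 order_trans[OF _ abs_ge_self]\<close>)
  have BJ: "B * J = 2 * (1 / real m * A * r ^ m * (1 - r\<^sup>2) powr (- (real m / 2)))"
  proof -
    \<comment> \<open>The power of \<open>real m\<close> in the density cancels the one produced by
      \<open>1 / real m\<close> in \<open>q\<close>; the denominator of \<open>J\<close> supplies
      \<open>2 / real m\<close>.\<close>
    have "real m powr (real m / 2) * q powr (real m / 2) = (r\<^sup>2 / (1 - r\<^sup>2)) powr (real m / 2)"
      using m r2 by (simp add: q_def powr_mult[symmetric])
    also have "\<dots> = r ^ m * (1 - r\<^sup>2) powr (- (real m / 2))"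
    proof -
      have "(r\<^sup>2) powr (real m / 2) = r ^ m"
        using powr_powr[of r 2 "real m / 2"] r by (simp add: powr_realpow)
      then show ?thesis using r2 by (simp add: powr_divide powr_minus_divide)
    qed
    finally show ?thesis by (simp add: B_def J_def)
  qed
  show "(LBINT x:{0..q}. F_density m x) \<le> 2 * (1 / real m * A * r ^ m * (1 - r\<^sup>2) powr (- (real m / 2)))"
    unfolding BJ[symmetric] val[symmetric] by (rule set_integral_mono[OF F int upper])
  \<comment> \<open>The lower bound is the upper one times \<open>s\<close>: the exponents
    \<open>- (real m / 2)\<close> and \<open>(real m + 1) / 2\<close> add up to
    \<open>1 / 2\<close>.\<close>
  have "(1 - r\<^sup>2) powr (- (real m / 2)) * s = sqrt (1 - r\<^sup>2)"
    using r2 by (simp add: s_def powr_add[symmetric] powr_half_sqrt[symmetric] add_divide_distrib)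
  then have "2 * (1 / real m * A * r ^ m * sqrt (1 - r\<^sup>2)) = (B * J) * s"
    unfolding BJ by simp
  also have "\<dots> = (LBINT x:{0..q}. B * s * x powr (real m / 2 - 1))"
    unfolding val by simp
  also have "\<dots> \<le> (LBINT x:{0..q}. F_density m x)"
    by (rule set_integral_mono[OF int F lower])
  finally show "2 * (1 / real m * A * r ^ m * sqrt (1 - r\<^sup>2)) \<le> (LBINT x:{0..q}. F_density m x)" .
qed

text \<open>Divided by \<open>r ^ m\<close>, the error is squeezed between two functions tending to
  \<open>0\<close>. Knowing \<open>p\<close> on \<open>0 < r < 1\<close> suffices, since only values
  of \<open>r\<close> just above \<open>0\<close> enter the limit.\<close>

lemma F_density_integral_asymp:
  fixes m :: nat
  assumes m: "0 < m"
    and p: "\<And>r. 0 < r \<Longrightarrow> r < 1 \<Longrightarrow> p r = 1 / 2 * (LBINT x:{0..1 / real m * (r\<^sup>2 / (1 - r\<^sup>2))}. F_density m x)"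
  shows "(\<lambda>r. p r - 1 / real m * (Gamma ((real m + 1) / 2) / (Gamma (real m / 2) * sqrt pi)) * r ^ m)
    \<in> o[at_right 0](\<lambda>r. r ^ m)"
proof (rule smalloI_tendsto)
  define A where "A = Gamma ((real m + 1) / 2) / (Gamma (real m / 2) * sqrt pi)"
  have ev: "\<forall>\<^sub>F r :: real in at_right 0. 0 < r \<and> r < 1"
    using eventually_at_right_real[of 0 1] by simp
  show "((\<lambda>r. (p r - 1 / real m * (Gamma ((real m + 1) / 2) / (Gamma (real m / 2) * sqrt pi)) * r ^ m) / r ^ m)
    \<longlongrightarrow> 0) (at_right 0)"
    unfolding A_def[symmetric]
  proof (rule tendsto_sandwich)
    show "\<forall>\<^sub>F r in at_right 0. 1 / real m * A * sqrt (1 - r\<^sup>2) - 1 / real m * A \<le> (p r - 1 / real m * A * r ^ m) / r ^ m"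
      using ev
    proof eventually_elim
      case (elim r)
      then have "1 / real m * A * r ^ m * sqrt (1 - r\<^sup>2) \<le> p r"
        using F_density_integral_bounds(1)[OF m, of r, folded A_def] p[of r] by linarith
      then show ?case using elim by (simp add: field_simps)
    qed
    show "\<forall>\<^sub>F r in at_right 0. (p r - 1 / real m * A * r ^ m) / r ^ m \<le>
        1 / real m * A * (1 - r\<^sup>2) powr (- (real m / 2)) - 1 / real m * A"
      using ev
    proof eventually_elim
      case (elim r)
      then have "p r \<le> 1 / real m * A * r ^ m * (1 - r\<^sup>2) powr (- (real m / 2))"
        using F_density_integral_bounds(2)[OF m, of r, folded A_def] p[of r] by linarith
      then show ?case using elim by (simp add: field_simps)
    qed
    have "((\<lambda>r. 1 / real m * A * sqrt (1 - r\<^sup>2) - 1 / real m * A) \<longlongrightarrow>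
        1 / real m * A * sqrt (1 - 0\<^sup>2) - 1 / real m * A) (at_right 0)"
      by (intro tendsto_intros)
    then show "((\<lambda>r. 1 / real m * A * sqrt (1 - r\<^sup>2) - 1 / real m * A) \<longlongrightarrow> 0) (at_right 0)" by simp
    have "((\<lambda>r. 1 / real m * A * (1 - r\<^sup>2) powr (- (real m / 2)) - 1 / real m * A) \<longlongrightarrow>
        1 / real m * A * (1 - 0\<^sup>2) powr (- (real m / 2)) - 1 / real m * A) (at_right 0)"
      by (intro tendsto_intros) auto
    then show "((\<lambda>r. 1 / real m * A * (1 - r\<^sup>2) powr (- (real m / 2)) - 1 / real m * A) \<longlongrightarrow> 0) (at_right 0)"
      by simp
  qed
  show "\<forall>\<^sub>F r :: real in at_right 0. r ^ m \<noteq> 0"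
    using ev by eventually_elim simp
qed

theorem theorem2p5:
  fixes M :: "'w measure"
    and V1 V2 :: "'w \<Rightarrow> real ^ 'n"
    and k :: 'n
    and d :: nat
  assumes "d = CARD('n)"
    and "d \<ge> 2"
    and "prob_space M"
    and "standard_normal_vector M V1"
    and "standard_normal_vector M V2"
    and "prob_space.indep_var M borel V1 borel V2"
  shows "(\<forall>r\<in>{0<..<1}.
            collision_prob M k V1 V2 r =
              1 / 2 * cdf (F_distribution (d - 1) 1) (1 / (real d - 1) * (r\<^sup>2 / (1 - r\<^sup>2))) \<and>
            collision_prob M k V1 V2 r =
              1 / 2 * (LBINT x:{0..1 / (real d - 1) * (r\<^sup>2 / (1 - r\<^sup>2))}.
                Gamma (real d / 2) / (Gamma ((real d - 1) / 2) * sqrt pi)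
                  * (real d - 1) powr ((real d - 1) / 2) * x powr ((real d - 3) / 2)
                  * (1 + (real d - 1) * x) powr (- (real d / 2)))) \<and>
         (\<lambda>r. collision_prob M k V1 V2 r
                - 1 / (real d - 1) * (Gamma (real d / 2) / (Gamma ((real d - 1) / 2) * sqrt pi))
                    * r ^ (d - 1))
           \<in> o[at_right 0](\<lambda>r. r ^ (d - 1))"
proof -
  interpret prob_space M by fact
  define m where "m = d - 1"
  have m: "m = CARD('n) - 1" "0 < m" using assms by (auto simp: m_def)
  \<comment> \<open>The subtraction in \<open>d - 1\<close> is on naturals; it agrees with the real
    one because \<open>d \<ge> 2\<close>.\<close>
  have d: "real m = real d - 1" using assms by (simp add: m_def of_nat_diff)
  have cdf: "collision_prob M k V1 V2 r = 1 / 2 * cdf (F_distribution m 1) (1 / real m * (r\<^sup>2 / (1 - r\<^sup>2)))"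
    if "0 < r" "r < 1" for r
    using collision_prob_eq_cdf[OF that m assms(4-6)] .
  have F: "F_density m = (\<lambda>x. Gamma (real d / 2) / (Gamma ((real d - 1) / 2) * sqrt pi)
                  * (real d - 1) powr ((real d - 1) / 2) * x powr ((real d - 3) / 2)
                  * (1 + (real d - 1) * x) powr (- (real d / 2)))"
  proof -
    have "(real d - 1) / 2 - 1 = (real d - 3) / 2" by (simp add: field_simps)
    then show ?thesis unfolding F_density_def[abs_def] d by (simp only: diff_add_cancel)
  qed
  have int: "collision_prob M k V1 V2 r = 1 / 2 * (LBINT x:{0..1 / real m * (r\<^sup>2 / (1 - r\<^sup>2))}. F_density m x)"
    if "0 < r" "r < 1" for r
    using cdf[OF that] cdf_F_distribution[OF m(2)] by simp
  have "(\<lambda>r. collision_prob M k V1 V2 r - 1 / (real d - 1) *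
      (Gamma (real d / 2) / (Gamma ((real d - 1) / 2) * sqrt pi)) * r ^ m) \<in> o[at_right 0](\<lambda>r. r ^ m)"
    using F_density_integral_asymp[OF m(2) int] unfolding d by simp
  then show ?thesis
  proof (intro conjI ballI)
    fix r :: real assume "r \<in> {0<..<1}"
    then have r: "0 < r" "r < 1" by auto
    show "collision_prob M k V1 V2 r =
        1 / 2 * cdf (F_distribution (d - 1) 1) (1 / (real d - 1) * (r\<^sup>2 / (1 - r\<^sup>2)))"
      \<comment> \<open>The order matters: \<open>real m\<close> first becomes
        \<open>real d - 1\<close>, and only the remaining natural-number \<open>m\<close> is then
        unfolded to \<open>d - 1\<close>.\<close>
      using cdf[OF r] unfolding d unfolding m_def .
    show "collision_prob M k V1 V2 r =
        1 / 2 * (LBINT x:{0..1 / (real d - 1) * (r\<^sup>2 / (1 - r\<^sup>2))}.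
          Gamma (real d / 2) / (Gamma ((real d - 1) / 2) * sqrt pi)
            * (real d - 1) powr ((real d - 1) / 2) * x powr ((real d - 3) / 2)
            * (1 + (real d - 1) * x) powr (- (real d / 2)))"
      using int[OF r] unfolding F d .
  qed (simp only: m_def)
qed

end
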